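(* Let $\widehat N=\begin{pmatrix}\widehat A&\widehat B\\ I&O\end{pmatrix}\in\mathbb{DC}_z^{n\times n}$, where $\widehat A$ and $\widehat B$ are square of the same order and dual Drazin invertible, with $\mathrm{Ind}_s(\widehat A)=i_{\widehat A}$ and $\mathrm{Ind}_s(\widehat B)=i_{\widehat B}$. Assume $\widehat A\widehat A^\pi\widehat B=\widehat B\widehat A\widehat A^\pi$ and $\widehat A\widehat A^e\widehat B=O$. Then $$\widehat N^D=\begin{pmatrix}\sum\limits_{i=0}^{i_{\widehat B}-1}\widehat B^\pi\widehat B^i\widehat A^{(2i+1)D}&\widehat B^e\\ \sum\limits_{i=0}^{i_{\widehat B}-1}\widehat B^\pi\widehat B^i\widehat A^{(2i+2)D}+\widehat B^D\widehat A^\pi&-\widehat A\widehat A^\pi\widehat B^D\end{pmatrix}.$$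
   Context: Dual numbers: $\varepsilon\neq0$, $\varepsilon^2=0$, commuting with complex matrices. $\mathbb{DC}^{n\times n}$ denotes matrices $\widehat{A}=A+\varepsilon A_0$ with $A,A_0\in\mathbb{C}^{n\times n}$. For complex $A$, $\mathrm{Ind}(A)$ is the least $k\ge0$ with $\operatorname{rank}A^k=\operatorname{rank}A^{k+1}$ and $A^D$ its Drazin inverse. $\mathbb{DC}_z^{n\times n}$ is the set of $\widehat{A}=A+\varepsilon A_0$ with $(I-AA^D)\big(\sum_{i=1}^{k}A^{k-i}A_0A^{i-1}\big)(I-AA^D)=O$, $k=\mathrm{Ind}(A)$; "dual Drazin invertible" means belonging to this set. For such $\widehat A$, the dual Drazin inverse $\widehat A^D$ is the unique $\widehat X$ with $\widehat A^k\widehat X\widehat A=\widehat A^k$, $\widehat X\widehat A\widehat X=\widehat X$, $\widehat A\widehat X=\widehat X\widehat A$. $\mathrm{Ind}_s(\widehat A):=\mathrm{Ind}(A)$. $\widehat A^{sD}=(\widehat A^D)^s$, $\widehat A^e=\widehat A\widehat A^D$, $\widehat A^\pi=I-\widehat A^e$, $\widehat A^0=I$; empty sums are zero. *)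

theory Defs
  imports Complex_Main "Jordan_Normal_Form.Matrix" "Jordan_Normal_Form.DL_Rank"
begin

text \<open>
  \<open>Dual a b\<close> is the dual complex number \<open>a + \<epsilon> b\<close>, where \<open>\<epsilon> \<noteq> 0\<close> and \<open>\<epsilon>\<^sup>2 = 0\<close>;
  see \<open>dual_complex_eq\<close> and \<open>eps_power2\<close> below. A matrix \<open>A + \<epsilon> A\<^sub>0\<close> over the dual numbers is
  a matrix with entries in this commutative ring; its parts \<open>A\<close> and \<open>A\<^sub>0\<close> are
  \<open>std_mat\<close> and \<open>inf_mat\<close>.
\<close>

datatype dual_complex = Dual (std_part: complex) (inf_part: complex)

instantiation dual_complex :: comm_ring_1
begin

definition "0 = Dual 0 0"
definition "1 = Dual 1 0"
definition "x + y = Dual (std_part x + std_part y) (inf_part x + inf_part y)"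
definition "- x = Dual (- std_part x) (- inf_part x)"
definition "x - y = Dual (std_part x - std_part y) (inf_part x - inf_part y)"
definition "x * y = Dual (std_part x * std_part y)
                         (std_part x * inf_part y + inf_part x * std_part y)"

instance
  by standard
    (simp_all add: zero_dual_complex_def one_dual_complex_def plus_dual_complex_def
      uminus_dual_complex_def minus_dual_complex_def times_dual_complex_def algebra_simps)

end

definition eps :: dual_complex where "eps = Dual 0 1"

lemma eps_nonzero: "eps \<noteq> 0"
  by (simp add: eps_def zero_dual_complex_def)

lemma eps_power2: "eps\<^sup>2 = 0"
  by (simp add: eps_def power2_eq_square times_dual_complex_def zero_dual_complex_def)

lemma dual_complex_eq: "Dual a b = Dual a 0 + eps * Dual b 0"
  by (simp add: eps_def plus_dual_complex_def times_dual_complex_def)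

abbreviation std_mat :: "dual_complex mat \<Rightarrow> complex mat" where
  "std_mat \<equiv> map_mat std_part"

abbreviation inf_mat :: "dual_complex mat \<Rightarrow> complex mat" where
  "inf_mat \<equiv> map_mat inf_part"

text \<open>
  Matrices of unspecified dimension have no zero, hence no \<open>sum\<close>; the dimension is therefore an
  explicit argument here. All summands are meant to lie in \<open>carrier_mat n n\<close>, and the empty sum is
  \<open>0\<^sub>m n n\<close>.
\<close>

definition msum :: "nat \<Rightarrow> ('i \<Rightarrow> 'a :: semiring_1 mat) \<Rightarrow> 'i set \<Rightarrow> 'a mat" where
  "msum n F I = finsum (module_mat TYPE('a) n n) F I"

definition Ind :: "complex mat \<Rightarrow> nat" where
  "Ind A = (LEAST k. vec_space.rank (dim_row A) (A ^\<^sub>m k)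
                   = vec_space.rank (dim_row A) (A ^\<^sub>m (k + 1)))"

definition is_drazin_inverse :: "nat \<Rightarrow> 'a :: semiring_1 mat \<Rightarrow> 'a mat \<Rightarrow> bool" where
  "is_drazin_inverse k A X \<longleftrightarrow>
     X \<in> carrier_mat (dim_row A) (dim_row A) \<and>
     A ^\<^sub>m k * X * A = A ^\<^sub>m k \<and> X * A * X = X \<and> A * X = X * A"

definition drazin_inverse :: "complex mat \<Rightarrow> complex mat" where
  "drazin_inverse A = (THE X. is_drazin_inverse (Ind A) A X)"

definition Ind_s :: "dual_complex mat \<Rightarrow> nat" where
  "Ind_s A = Ind (std_mat A)"

text \<open>The set \<open>DC\<^sub>z\<close> of dual Drazin invertible matrices of order \<open>n\<close>.\<close>

definition DCz :: "nat \<Rightarrow> dual_complex mat set" where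
  "DCz n = {Ah \<in> carrier_mat n n.
     let A = std_mat Ah; A0 = inf_mat Ah; k = Ind A; P = 1\<^sub>m n - A * drazin_inverse A
     in P * msum n (\<lambda>i. A ^\<^sub>m (k - i) * A0 * A ^\<^sub>m (i - 1)) {1..k} * P = 0\<^sub>m n n}"

text \<open>Meaningful only for matrices in \<open>DCz n\<close>, for which the dual Drazin inverse is unique.\<close>

definition dual_drazin_inverse :: "dual_complex mat \<Rightarrow> dual_complex mat" (\<open>_\<^sup>D\<close> [1000] 999) where
  "A\<^sup>D = (THE X. is_drazin_inverse (Ind_s A) A X)"

text \<open>\<open>A ^D s\<close> is \<open>A\<^bsup>sD\<^esup> = (A\<^sup>D)\<^bsup>s\<^esup>\<close>.\<close>

abbreviation dual_drazin_power :: "dual_complex mat \<Rightarrow> nat \<Rightarrow> dual_complex mat"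
    (infixr \<open>^D\<close> 75) where
  "A ^D s \<equiv> (A\<^sup>D) ^\<^sub>m s"

definition dual_e :: "dual_complex mat \<Rightarrow> dual_complex mat" (\<open>_\<^sup>e\<close> [1000] 999) where
  "A\<^sup>e = A * A\<^sup>D"

definition dual_pi :: "dual_complex mat \<Rightarrow> dual_complex mat" (\<open>_\<^sup>\<pi>\<close> [1000] 999) where
  "A\<^sup>\<pi> = 1\<^sub>m (dim_row A) - A\<^sup>e"

end

theory Submission
  imports Defs
begin

text \<open>
  The claimed block matrix \<open>X\<close> commutes with \<open>N\<close> and satisfies \<open>X N X = X\<close> by direct computation.
  For the remaining condition, \<open>N (I - N X)\<close> is split as \<open>M\<^sub>1 + M\<^sub>2\<close>, where \<open>M\<^sub>2\<close> annihilates the sum from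
  the left and \<open>M\<^sub>1\<^sup>2 = a M\<^sub>1 + b\<close> with \<open>a = A A\<^sup>\<pi>\<close> and \<open>b = B B\<^sup>\<pi>\<close> commuting nilpotents, so \<open>N (I - N X)\<close> is
  nilpotent. Hence \<open>X\<close> is a Drazin inverse of \<open>N\<close> of some index, and Drazin inverses of different indices
  coincide. That a matrix in \<open>DC\<^sub>z\<close> has a Drazin inverse of the index of its standard part follows
  from strong \<open>\<pi>\<close>-regularity: the defining condition of \<open>DC\<^sub>z\<close> allows solving
  \<open>A\<^sup>k = A\<^sup>k\<^sup>+\<^sup>1 V = W A\<^sup>k\<^sup>+\<^sup>1\<close> over the dual numbers.
\<close>

section \<open>Drazin inverses in monoids and rings\<close>

context monoid
begin

definition drazin :: "nat \<Rightarrow> 'a \<Rightarrow> 'a \<Rightarrow> bool" where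
  "drazin k a x \<longleftrightarrow> x \<in> carrier G \<and> a [^] k \<otimes> x \<otimes> a = a [^] k \<and> x \<otimes> a \<otimes> x = x \<and> a \<otimes> x = x \<otimes> a"

lemma pow_commute:
  assumes "a \<in> carrier G" "c \<in> carrier G" "c \<otimes> a = a \<otimes> c"
  shows "c \<otimes> a [^] (k::nat) = a [^] k \<otimes> c"
  using group_commutes_pow[of a c k] assms by simp

lemma drazin_mono:
  assumes a: "a \<in> carrier G" and "drazin k a x" and "k \<le> l"
  shows "drazin l a x"
proof -
  note x = \<open>drazin k a x\<close>[unfolded drazin_def]
  obtain i where l: "l = i + k" using \<open>k \<le> l\<close> le_Suc_ex by (metis add.commute)
  have "a [^] l \<otimes> x \<otimes> a = a [^] i \<otimes> (a [^] k \<otimes> x \<otimes> a)"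
    using a x by (simp add: l nat_pow_mult[symmetric] m_assoc)
  then show ?thesis using a x by (simp add: drazin_def l nat_pow_mult)
qed

text \<open>On the corner cut out by \<open>e\<close> the element \<open>a\<close> is invertible
  with inverse \<open>x\<close>, so \<open>e\<close> absorbs \<open>x\<close> and high powers of
  \<open>a\<close>, and equal positive powers of \<open>a\<close> and \<open>x\<close> cancel to
  \<open>e\<close>.\<close>

lemma drazin_idem:
  assumes a: "a \<in> carrier G" and "drazin k a x"
  defines "e \<equiv> a \<otimes> x"
  shows "e \<in> carrier G" "e \<otimes> e = e" "e \<otimes> x = x" "x \<otimes> e = x" "e \<otimes> a = a \<otimes> e"
    "a [^] k \<otimes> e = a [^] k" "e \<otimes> a [^] k = a [^] k" "a [^] Suc n \<otimes> x [^] Suc n = e"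
proof -
  note x = \<open>drazin k a x\<close>[unfolded drazin_def]
  have xc: "x \<in> carrier G" and comm: "a \<otimes> x = x \<otimes> a" and xax: "x \<otimes> (a \<otimes> x) = x"
    using x a by (auto simp: m_assoc)
  show e: "e \<in> carrier G" using a xc by (simp add: e_def)
  show xe: "x \<otimes> e = x" using xax by (simp add: e_def)
  then show ex: "e \<otimes> x = x" using comm a xc by (metis e_def m_assoc)
  show ee: "e \<otimes> e = e" using xe a xc e by (metis e_def m_assoc)
  show ea: "e \<otimes> a = a \<otimes> e" using comm a xc by (metis e_def m_assoc)
  show ake: "a [^] k \<otimes> e = a [^] k"
    using x a by (metis comm e_def m_assoc nat_pow_closed)
  show "e \<otimes> a [^] k = a [^] k" using pow_commute[OF a e ea, of k] ake by simp
  show "a [^] Suc n \<otimes> x [^] Suc n = e"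
  proof (induction n)
    case 0 then show ?case using a xc by (simp add: e_def)
  next
    case (Suc n)
    have "a [^] Suc (Suc n) \<otimes> x [^] Suc (Suc n) = a \<otimes> (a [^] Suc n \<otimes> x [^] Suc n) \<otimes> x"
      unfolding nat_pow_Suc2[OF a, of "Suc n"] nat_pow_Suc[of x "Suc n"]
      using a xc by (simp add: m_assoc del: nat_pow_Suc)
    also have "\<dots> = e" unfolding Suc using a xc e ex by (simp add: m_assoc e_def)
    finally show ?case .
  qed
qed

text \<open>This is the double commutant property. With \<open>e = p q = q p\<close> and
  \<open>p\<close> a power of \<open>a\<close>, an element \<open>c\<close> commuting with
  \<open>a\<close> satisfies \<open>e c = e c e = c e\<close>; then
  \<open>x c = x c a x = x a c x = c x\<close>.\<close>

lemma drazin_commute: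
  assumes a: "a \<in> carrier G" and x: "drazin k a x"
    and c: "c \<in> carrier G" and ca: "c \<otimes> a = a \<otimes> c"
  shows "c \<otimes> x = x \<otimes> c"
proof -
  define e where "e = a \<otimes> x"
  define p where "p = a [^] Suc k"
  define q where "q = x [^] Suc k"
  have xc: "x \<in> carrier G" and comm: "a \<otimes> x = x \<otimes> a" using x by (auto simp: drazin_def)
  \<comment> \<open>The index is raised by one so that the absorption laws hold for
    \<open>p\<close>, whose exponent must be positive for the cancellation
    \<open>p q = e\<close>.\<close>
  have xS: "drazin (Suc k) a x" by (rule drazin_mono[OF a x]) simp
  note E = drazin_idem[OF a xS, folded e_def p_def]
  have e: "e \<in> carrier G" and p: "p \<in> carrier G" and q: "q \<in> carrier G"
    using a xc by (auto simp: e_def p_def q_def)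
  have pq: "p \<otimes> q = e" using drazin_idem(8)[OF a x, of k] by (simp only: p_def q_def e_def)
  have "x \<otimes> a = a \<otimes> x" using comm by simp
  then have "x \<otimes> p = p \<otimes> x" unfolding p_def by (rule pow_commute[OF a xc])
  then have "p \<otimes> x = x \<otimes> p" by simp
  then have qp: "q \<otimes> p = e" using pow_commute[OF xc p, of "Suc k"] pq by (simp only: q_def)
  have cp: "c \<otimes> p = p \<otimes> c" unfolding p_def by (rule pow_commute[OF a c ca])
  have "e \<otimes> c = q \<otimes> (c \<otimes> p)" using c p q by (simp add: qp[symmetric] cp m_assoc)
  also have "\<dots> = q \<otimes> (c \<otimes> p) \<otimes> e" using E(6) c p q e by (simp add: m_assoc)
  also have "\<dots> = e \<otimes> c \<otimes> e" using c p q e by (simp add: qp[symmetric] cp m_assoc)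
  finally have 1: "e \<otimes> c = e \<otimes> c \<otimes> e" .
  have "c \<otimes> e = p \<otimes> c \<otimes> q" using c p q by (simp add: pq[symmetric] cp[symmetric] m_assoc)
  also have "\<dots> = e \<otimes> p \<otimes> c \<otimes> q" by (simp add: E(7))
  also have "\<dots> = e \<otimes> c \<otimes> e" using c p q e by (simp add: pq[symmetric] cp[symmetric] m_assoc)
  finally have ce: "c \<otimes> e = e \<otimes> c" using 1 by simp
  have "x \<otimes> c = x \<otimes> (e \<otimes> c)" using E(4) xc e c by (simp add: m_assoc[symmetric])
  also have "\<dots> = x \<otimes> (c \<otimes> a) \<otimes> x" using xc a c by (simp add: ce[symmetric] m_assoc, simp add: e_def m_assoc)
  also have "\<dots> = e \<otimes> c \<otimes> x" using xc a c comm by (simp add: ca e_def m_assoc[symmetric])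
  also have "\<dots> = c \<otimes> x" using E(3) xc e c by (simp add: ce[symmetric] m_assoc)
  finally show ?thesis by simp
qed

text \<open>The indices \<open>k\<close> and \<open>l\<close> may differ, so an inverse can be
  checked at any convenient exponent. Both idempotents absorb a common high power of
  \<open>a\<close>, which yields \<open>f e = e\<close> and \<open>e f = f\<close>; they commute by
  \<open>drazin_commute\<close>, so they agree, and then \<open>x = x a y = y\<close>.\<close>

lemma drazin_unique:
  assumes a: "a \<in> carrier G" and x: "drazin k a x" and y: "drazin l a y"
  shows "x = y"
proof -
  define n where "n = max k l"
  define e where "e = a \<otimes> x"
  define f where "f = a \<otimes> y"
  define p where "p = a [^] Suc n"
  have xn: "drazin (Suc n) a x" and yn: "drazin (Suc n) a y"
    using x y by (auto intro: drazin_mono[OF a] simp: n_def)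
  note E = drazin_idem[OF a xn, folded e_def p_def]
  note F = drazin_idem[OF a yn, folded f_def p_def]
  have xc: "x \<in> carrier G" and yc: "y \<in> carrier G" and p: "p \<in> carrier G"
    using x y a by (auto simp: drazin_def p_def)
  have fe: "f \<otimes> e = e"
    using F(7) E(8)[of n, folded p_def] F(1) p xc by (metis m_assoc nat_pow_closed)
  have ef: "e \<otimes> f = f"
    using E(7) F(8)[of n, folded p_def] E(1) p yc by (metis m_assoc nat_pow_closed)
  have fa: "f \<otimes> a = a \<otimes> f" by (rule F(5))
  have "f \<otimes> x = x \<otimes> f" by (rule drazin_commute[OF a x F(1) fa])
  then have "f \<otimes> e = e \<otimes> f" using fa a xc F(1) by (metis e_def m_assoc)
  then have "e = f" using fe ef by simp
  have "x = x \<otimes> a \<otimes> y" using E(4) \<open>e = f\<close> a xc yc by (simp add: f_def m_assoc)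
  also have "\<dots> = y" using F(3) \<open>e = f\<close> x by (simp add: drazin_def e_def)
  finally show ?thesis .
qed

text \<open>The witness is \<open>x = a\<^sup>k v\<^sup>k\<^sup>+\<^sup>1 = w\<^sup>k\<^sup>+\<^sup>1 a\<^sup>k\<close>.\<close>

lemma drazin_exists:
  assumes a: "a \<in> carrier G" and v: "v \<in> carrier G" and w: "w \<in> carrier G"
    and right: "a [^] k = a [^] Suc k \<otimes> v" and left: "a [^] k = w \<otimes> a [^] Suc k"
  shows "\<exists>x. drazin k a x"
proof -
  define p where "p = a [^] k"
  define V where "V = v [^] Suc k"
  define W where "W = w [^] Suc k"
  have c: "p \<in> carrier G" "V \<in> carrier G" "W \<in> carrier G" using a v w by (auto simp: p_def V_def W_def)
  have ap: "a \<otimes> p = p \<otimes> a" using a by (simp add: p_def pow_commute)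
  have pv: "p = p \<otimes> a \<otimes> v" and wp: "p = w \<otimes> (p \<otimes> a)"
    using right left unfolding p_def nat_pow_Suc .
  \<comment> \<open>Iterating \<open>p = p a v\<close> spreads the new factors to both sides of
    \<open>p\<close>; at exponent \<open>Suc k\<close> the left factor is \<open>t = p a\<close> and
    the right one is \<open>V\<close>. The mirrored iteration \<open>L\<close> produces
    \<open>W\<close> and \<open>t\<close>.\<close>
  have R: "p = a [^] i \<otimes> p \<otimes> v [^] i" for i :: nat
  proof (induction i)
    case 0 then show ?case using c by simp
  next
    case (Suc i)
    have "p = a [^] i \<otimes> (p \<otimes> a \<otimes> v) \<otimes> v [^] i"
      unfolding pv[symmetric] by (rule Suc)
    also have "\<dots> = (a [^] i \<otimes> a) \<otimes> p \<otimes> (v \<otimes> v [^] i)"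
      using a v c ap[symmetric] by (simp add: m_assoc)
    finally show ?case using v by (simp add: pow_commute[of v v])
  qed
  have L: "p = w [^] i \<otimes> p \<otimes> a [^] i" for i :: nat
  proof (induction i)
    case 0 then show ?case using c by simp
  next
    case (Suc i)
    have "p = w [^] i \<otimes> (w \<otimes> (p \<otimes> a)) \<otimes> a [^] i"
      unfolding wp[symmetric] by (rule Suc)
    also have "\<dots> = (w [^] i \<otimes> w) \<otimes> p \<otimes> (a \<otimes> a [^] i)"
      using a w c by (simp add: m_assoc)
    finally show ?case using a by (simp add: pow_commute[of a a])
  qed
  define t where "t = p \<otimes> a"
  have t: "t \<in> carrier G" "t = a [^] Suc k" using a c by (auto simp: t_def p_def)
  have ta: "t \<otimes> a = a \<otimes> t" using a c unfolding t_def by (metis ap m_assoc)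
  have tp: "t \<otimes> p = p \<otimes> t" using a c ap by (simp add: t_def m_assoc)
  have PR: "p = t \<otimes> p \<otimes> V" using R[of "Suc k"] by (simp only: V_def t)
  have PL: "p = W \<otimes> p \<otimes> t" using L[of "Suc k"] by (simp only: W_def t)
  define x where "x = p \<otimes> V"
  have "x = W \<otimes> p \<otimes> t \<otimes> V" using PL by (simp add: x_def)
  also have "\<dots> = W \<otimes> (t \<otimes> p \<otimes> V)" using c t tp by (simp add: m_assoc)
  finally have xW: "x = W \<otimes> p" using PR by simp
  have x: "x \<in> carrier G" using c by (simp add: x_def)
  have tx: "t \<otimes> x = p" using PR c t by (simp add: x_def m_assoc)
  have xt: "x \<otimes> t = p" using PL c t by (simp add: xW m_assoc)
  \<comment> \<open>Commutation plays \<open>x = p V\<close> against \<open>x = W p\<close>: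
    replacing \<open>p\<close> by \<open>x t\<close> creates a second copy of \<open>t\<close>, and
    \<open>t p V = p\<close> collapses the product again.\<close>
  have "a \<otimes> x = a \<otimes> p \<otimes> V" using a c by (simp add: x_def m_assoc)
  also have "\<dots> = x \<otimes> t \<otimes> a \<otimes> V" using ap xt by simp
  also have "\<dots> = x \<otimes> a \<otimes> t \<otimes> V" using x t a c ta by (simp add: m_assoc)
  also have "x \<otimes> a = W \<otimes> t" using c a by (simp add: xW t_def m_assoc)
  also have "W \<otimes> t \<otimes> t \<otimes> V = W \<otimes> t \<otimes> (a \<otimes> p) \<otimes> V" by (simp only: ap t_def)
  also have "\<dots> = W \<otimes> (t \<otimes> a) \<otimes> p \<otimes> V" using c t a by (simp add: m_assoc)
  also have "\<dots> = W \<otimes> (a \<otimes> (t \<otimes> p \<otimes> V))" unfolding ta using c t a by (simp add: m_assoc)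
  also have "\<dots> = x \<otimes> a" using a c ap PR by (simp add: xW m_assoc)
  finally have comm: "a \<otimes> x = x \<otimes> a" .
  have "p \<otimes> x \<otimes> a = t \<otimes> x" using a c x comm by (simp add: t_def m_assoc)
  then have 1: "p \<otimes> x \<otimes> a = p" using tx by simp
  have "x \<otimes> a \<otimes> x = W \<otimes> (t \<otimes> x)" using c a t x by (simp add: xW t_def m_assoc)
  then have 2: "x \<otimes> a \<otimes> x = x" using tx xW by simp
  show ?thesis using 1 2 comm x unfolding drazin_def p_def by blast
qed

text \<open>Iterating the relation gives \<open>a^k = a^l a^k z^l\<close>, which puts a factor
  \<open>a^l\<close> on the left, and that factor is fixed by the idempotent
  \<open>a x\<close>.\<close>

lemma drazin_lower_index:
  assumes a: "a \<in> carrier G" and x: "drazin l a x"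
    and z: "z \<in> carrier G" and eq: "a [^] k = a [^] Suc k \<otimes> z"
  shows "drazin k a x"
proof -
  have iter: "a [^] k = a [^] i \<otimes> a [^] k \<otimes> z [^] i" for i :: nat
  proof (induction i)
    case 0 then show ?case using a by simp
  next
    case (Suc i)
    have "a [^] k = a [^] i \<otimes> (a [^] Suc k \<otimes> z) \<otimes> z [^] i" unfolding eq[symmetric] by (rule Suc)
    also have "a [^] Suc k = a \<otimes> a [^] k" by (rule nat_pow_Suc2[OF a])
    also have "a [^] i \<otimes> (a \<otimes> a [^] k \<otimes> z) \<otimes> z [^] i = a [^] Suc i \<otimes> a [^] k \<otimes> z [^] Suc i"
      unfolding nat_pow_Suc2[OF z] using a z by (simp add: m_assoc)
    finally show ?case .
  qed
  note E = drazin_idem[OF a x]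
  have xc: "x \<in> carrier G" and ax: "a \<otimes> x = x \<otimes> a" using x by (auto simp: drazin_def)
  have "a [^] k \<otimes> x \<otimes> a = a \<otimes> x \<otimes> a [^] k"
    using pow_commute[OF a E(1,5)] a xc by (simp add: m_assoc ax)
  also have "\<dots> = a \<otimes> x \<otimes> (a [^] l \<otimes> a [^] k \<otimes> z [^] l)" using iter by simp
  also have "\<dots> = a \<otimes> x \<otimes> a [^] l \<otimes> a [^] k \<otimes> z [^] l"
    using a xc z by (simp add: m_assoc)
  also have "\<dots> = a [^] k" using iter E(7) by simp
  finally show ?thesis using x by (simp add: drazin_def)
qed

end

section \<open>Nilpotency and the complementary idempotent in rings\<close>

context ring
begin

lemma nilpotent_add:
  assumes x: "x \<in> carrier R" and y: "y \<in> carrier R" and comm: "x \<otimes> y = y \<otimes> x"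
    and xs: "x [^] (s::nat) = \<zero>" and yt: "y [^] (t::nat) = \<zero>"
  shows "(x \<oplus> y) [^] (s + t) = \<zero>"
proof -
  \<comment> \<open>All mixed products are treated at once: expanding one factor of the remaining
    power raises one of the exponents and keeps the total, so no binomial coefficients
    occur.\<close>
  have "x [^] i \<otimes> y [^] j \<otimes> (x \<oplus> y) [^] r = \<zero>" if "i + j + r \<ge> s + t" for i j r :: nat
    using that
  proof (induction r arbitrary: i j)
    case 0
    then have "i \<ge> s \<or> j \<ge> t" by linarith
    moreover have "x [^] i = \<zero>" if "i \<ge> s"
      using that xs x by (metis le_Suc_ex nat_pow_mult nat_pow_closed l_null)
    moreover have "y [^] j = \<zero>" if "j \<ge> t"
      using that yt y by (metis le_Suc_ex nat_pow_mult nat_pow_closed l_null)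
    ultimately show ?case using x y by auto
  next
    case (Suc r)
    have yx: "x \<otimes> y [^] j = y [^] j \<otimes> x" using pow_commute[OF y x comm] .
    have "x [^] i \<otimes> y [^] j \<otimes> (x \<oplus> y) [^] Suc r
      = x [^] i \<otimes> (y [^] j \<otimes> x) \<otimes> (x \<oplus> y) [^] r \<oplus> x [^] i \<otimes> (y [^] j \<otimes> y) \<otimes> (x \<oplus> y) [^] r"
      unfolding nat_pow_Suc2[OF a_closed[OF x y]] using x y
      by (simp add: m_assoc l_distr r_distr)
    also have "\<dots> = x [^] Suc i \<otimes> y [^] j \<otimes> (x \<oplus> y) [^] r \<oplus> x [^] i \<otimes> y [^] Suc j \<otimes> (x \<oplus> y) [^] r"
      using x y by (simp add: yx[symmetric] m_assoc)
    also have "\<dots> = \<zero>" using Suc.IH[of "Suc i" j] Suc.IH[of i "Suc j"] Suc.prems by simp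
    finally show ?case .
  qed
  from this[of 0 0 "s + t"] show ?thesis using x y by simp
qed

end

context ring
begin

text \<open>The exponent is kept positive, since at exponent zero the left side is the unit while
  the right side would be \<open>u\<close>.\<close>

lemma pow_mult_idem:
  assumes n: "n \<in> carrier R" and u: "u \<in> carrier R" and "n \<otimes> u = u \<otimes> n" and "u \<otimes> u = u"
  shows "(n \<otimes> u) [^] Suc j = n [^] Suc j \<otimes> u"
proof (induction j)
  case (Suc j)
  have "(n \<otimes> u) [^] Suc (Suc j) = n [^] Suc j \<otimes> (u \<otimes> n) \<otimes> u"
    unfolding nat_pow_Suc[of _ "Suc j"] Suc using n u by (simp add: m_assoc)
  also have "\<dots> = n [^] Suc (Suc j) \<otimes> (u \<otimes> u)"
    using assms(3) n u by (simp add: m_assoc flip: assms(3))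
  finally show ?case using assms(4) by simp
qed (use n u in simp)

text \<open>\<open>u\<close> projects onto the nilpotent part of \<open>a\<close>. The last exponent
  is \<open>Suc k\<close> because \<open>k = 0\<close> is allowed, where a zeroth power would be the
  unit.\<close>

lemma drazin_complement:
  assumes a: "a \<in> carrier R" and "drazin k a x"
  defines "u \<equiv> \<one> \<ominus> a \<otimes> x"
  shows "u \<in> carrier R" "u \<otimes> u = u" "a \<otimes> u = u \<otimes> a" "u \<otimes> x = \<zero>" "x \<otimes> u = \<zero>"
    "u \<otimes> a [^] k = \<zero>" "a [^] k \<otimes> u = \<zero>" "(a \<otimes> u) [^] Suc k = \<zero>"
proof -
  note E = drazin_idem[OF assms(1,2)]
  have x: "x \<in> carrier R" using assms(2) by (simp add: drazin_def)
  show u: "u \<in> carrier R" using a x by (simp add: u_def)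
  have ue: "u \<otimes> (a \<otimes> x) = \<zero>" using E(1,2) by (simp add: u_def minus_eq l_distr l_minus r_neg)
  show uu: "u \<otimes> u = u"
  proof -
    have "u \<otimes> u = u \<otimes> \<one> \<ominus> u \<otimes> (a \<otimes> x)"
      using u E(1) unfolding u_def by (simp add: minus_eq r_distr r_minus del: r_one)
    then show ?thesis using ue u by (simp add: minus_eq)
  qed
  show au: "a \<otimes> u = u \<otimes> a" using a E(1,5) by (simp add: u_def minus_eq l_distr r_distr l_minus r_minus)
  show "u \<otimes> x = \<zero>" using E(1,3) x by (simp add: u_def minus_eq l_distr l_minus r_neg)
  show "x \<otimes> u = \<zero>" using E(1,4) x by (simp add: u_def minus_eq r_distr r_minus r_neg)
  show "u \<otimes> a [^] k = \<zero>" using E(1,7) a by (simp add: u_def minus_eq l_distr l_minus r_neg)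
  show ak: "a [^] k \<otimes> u = \<zero>" using E(1,6) a by (simp add: u_def minus_eq r_distr r_minus r_neg)
  have "(a \<otimes> u) [^] Suc k = a \<otimes> a [^] k \<otimes> u"
    unfolding pow_mult_idem[OF a u au uu] nat_pow_Suc2[OF a] ..
  then show "(a \<otimes> u) [^] Suc k = \<zero>" using ak a u by (simp add: m_assoc)
qed

text \<open>Trades the power equation of a Drazin inverse for nilpotency of \<open>n u\<close>: the
  complement \<open>u\<close> of \<open>e = n x\<close> is an idempotent commuting with
  \<open>n\<close>, so \<open>(n u)^(j+1) = n^(j+1) - n^(j+1) e\<close>.\<close>

lemma drazin_if_nilpotent:
  assumes n: "n \<in> carrier R" and x: "x \<in> carrier R"
    and comm: "n \<otimes> x = x \<otimes> n" and xnx: "x \<otimes> (n \<otimes> x) = x"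
    and nil: "(n \<otimes> (\<one> \<ominus> n \<otimes> x)) [^] Suc j = \<zero>"
  shows "drazin (Suc j) n x"
proof -
  define e where "e = n \<otimes> x"
  define u where "u = \<one> \<ominus> e"
  have e: "e \<in> carrier R" and u: "u \<in> carrier R" using n x by (auto simp: e_def u_def)
  have ee: "e \<otimes> e = e" using xnx n x by (simp add: e_def m_assoc)
  have ne: "n \<otimes> e = e \<otimes> n" using n x unfolding e_def by (metis comm m_assoc)
  have ue: "u \<otimes> e = \<zero>" using e ee by (simp add: u_def minus_eq l_distr l_minus r_neg)
  have "u \<otimes> u = u \<otimes> \<one> \<ominus> u \<otimes> e"
    using u e unfolding u_def by (simp add: minus_eq r_distr r_minus del: r_one)
  then have uu: "u \<otimes> u = u" using ue u by (simp add: minus_eq)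
  have nu: "n \<otimes> u = u \<otimes> n" using n e ne by (simp add: u_def minus_eq l_distr r_distr l_minus r_minus)
  have "n [^] Suc j \<otimes> u = \<zero>"
    using nil unfolding e_def[symmetric] u_def[symmetric] pow_mult_idem[OF n u nu uu] .
  then have "n [^] Suc j \<ominus> n [^] Suc j \<otimes> e = \<zero>"
    using n e by (simp add: u_def minus_eq r_distr r_minus)
  then have "n [^] Suc j \<otimes> e = n [^] Suc j" using n e
    by (metis a_inv_closed m_closed minus_eq minus_equality minus_minus nat_pow_closed)
  then have "n [^] Suc j \<otimes> x \<otimes> n = n [^] Suc j"
    using n x comm by (metis e_def m_assoc nat_pow_closed)
  moreover have "x \<otimes> n \<otimes> x = x" using n x xnx by (simp add: m_assoc)
  ultimately show ?thesis using x comm by (simp add: drazin_def)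
qed

end

section \<open>The entrywise identities\<close>

text \<open>The entries of the block matrix are studied in an arbitrary ring; the theorem interprets
  it as the ring of dual matrices of order \<open>m\<close>.\<close>

locale drazin_block = ring +
  fixes A B D F and k l :: nat
  assumes A [simp]: "A \<in> carrier R" and B [simp]: "B \<in> carrier R"
    and AD: "drazin k A D" and BF: "drazin l B F"
    and comm: "A \<otimes> (\<one> \<ominus> A \<otimes> D) \<otimes> B = B \<otimes> A \<otimes> (\<one> \<ominus> A \<otimes> D)"
    and annih: "A \<otimes> (A \<otimes> D) \<otimes> B = \<zero>"
begin

definition "p = \<one> \<ominus> A \<otimes> D"
definition "q = \<one> \<ominus> B \<otimes> F"
definition "a = A \<otimes> p"
text \<open>Partial sums with a free bound make induction possible; at the bound \<open>l\<close>
  they give \<open>U\<close>, the upper left block of the claimed inverse.\<close>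

definition "psum n = finsum R (\<lambda>i. q \<otimes> B [^] (i::nat) \<otimes> D [^] (2 * i + 1)) {0..<n}"
definition "U = psum l"

lemma closed [simp]: "D \<in> carrier R" "F \<in> carrier R" "p \<in> carrier R" "q \<in> carrier R"
  "a \<in> carrier R" "psum n \<in> carrier R" "U \<in> carrier R"
proof -
  show 1: "D \<in> carrier R" "F \<in> carrier R" using AD BF by (auto simp: drazin_def)
  show 2: "p \<in> carrier R" "q \<in> carrier R" using 1 by (auto simp: p_def q_def)
  show "a \<in> carrier R" using 1 2 by (auto simp: a_def)
  show "psum n \<in> carrier R" for n using 1 2 by (auto simp: psum_def intro!: finsum_closed)
  then show "U \<in> carrier R" by (simp add: U_def)
qed

lemmas idemA = drazin_idem[OF A AD]
lemmas idemB = drazin_idem[OF B BF]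
lemmas complA = drazin_complement[OF A AD, folded p_def]
lemmas complB = drazin_complement[OF B BF, folded q_def]

lemma DA: "D \<otimes> A = A \<otimes> D" and FB: "F \<otimes> B = B \<otimes> F"
  using AD BF by (simp_all add: drazin_def)

lemma ADD: "A \<otimes> (D \<otimes> D) = D"
  using idemA(3) by (simp add: m_assoc)

lemma DDA: "D \<otimes> (D \<otimes> A) = D"
  using idemA(4) by (simp add: DA)

text \<open>Since \<open>D = D D A A D\<close>, the hypothesis \<open>annih\<close> applies inside
  the product. Consequently \<open>p B = B\<close> and \<open>A B = a B\<close>: in front of
  \<open>B\<close> only the nilpotent part of \<open>A\<close> survives.\<close>

lemma DB: "D \<otimes> B = \<zero>"
proof -
  have "D \<otimes> B = D \<otimes> (D \<otimes> A) \<otimes> B" by (simp add: DDA)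
  also have "D \<otimes> (D \<otimes> A) = D \<otimes> (D \<otimes> (A \<otimes> (A \<otimes> D)))"
    using ADD by (metis A DA DDA closed(1) m_assoc m_closed)
  also have "\<dots> \<otimes> B = D \<otimes> (D \<otimes> (A \<otimes> (A \<otimes> D) \<otimes> B))" by (simp add: m_assoc)
  finally show ?thesis using annih by simp
qed

lemma Dq: "D \<otimes> q = D"
  by (simp add: q_def minus_eq r_distr r_minus m_assoc[symmetric] DB)

lemma pB: "p \<otimes> B = B"
  by (simp add: p_def minus_eq l_distr l_minus m_assoc DB)

lemma AB: "A \<otimes> B = a \<otimes> B"
  by (simp add: a_def m_assoc pB)

lemma aB: "a \<otimes> B = B \<otimes> a"
  using comm by (simp add: a_def p_def m_assoc)

lemma aF: "a \<otimes> F = F \<otimes> a"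
  by (rule drazin_commute[OF B BF _ aB]) simp

lemma qB: "q \<otimes> B = B \<otimes> q" by (simp add: complB)
lemma Fq: "F \<otimes> q = \<zero>" by (simp add: complB)
lemma qq: "q \<otimes> q = q" by (simp add: complB)

lemma aBF: "a \<otimes> (B \<otimes> F) = B \<otimes> F \<otimes> a"
  by (simp add: m_assoc[symmetric] aB, simp add: m_assoc aF)

lemma aq: "a \<otimes> q = q \<otimes> a"
  using aBF by (simp add: q_def minus_eq r_distr l_distr l_minus r_minus)

lemma aD: "a \<otimes> D = \<zero>" and Da: "D \<otimes> a = \<zero>"
proof -
  show "a \<otimes> D = \<zero>" using complA(4) by (simp add: a_def m_assoc)
  show "D \<otimes> a = \<zero>" using complA(3,5) by (simp add: a_def m_assoc[symmetric])
qed

lemma aA: "a \<otimes> A = A \<otimes> a"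
  by (simp add: a_def complA(3)[symmetric] m_assoc)

lemma psum_Suc: "psum (Suc n) = psum n \<oplus> q \<otimes> B [^] n \<otimes> D [^] (2 * n + 1)"
  unfolding psum_def by (subst atLeast0_lessThan_Suc, subst finsum_insert) (auto simp: a_comm)

lemma psum_0: "psum 0 = \<zero>" by (simp add: psum_def)

lemma D_odd: "D [^] (2 * n + 1 :: nat) = D \<otimes> D [^] (2 * n)" "D [^] (2 * n + 1) = D [^] (2 * n) \<otimes> D"
  using nat_pow_Suc2[OF closed(1)] nat_pow_Suc[of D] by simp_all

text \<open>In each summand \<open>a\<close> passes \<open>q\<close> and the power of
  \<open>B\<close> until it meets \<open>D\<close>, and \<open>a D\<close> vanishes because
  \<open>p D\<close> does.\<close>

lemma a_psum: "a \<otimes> psum n = \<zero>"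
proof (induction n)
  case (Suc n)
  have "a \<otimes> (q \<otimes> B [^] n \<otimes> D [^] (2 * n + 1)) = q \<otimes> (B [^] n \<otimes> (a \<otimes> D)) \<otimes> D [^] (2 * n)"
    using pow_commute[OF B closed(5) aB, of n] unfolding D_odd(1)
    by (simp add: m_assoc[symmetric] aq, simp add: m_assoc)
  then show ?case using Suc by (simp add: psum_Suc r_distr aD)
qed (simp add: psum_0)

lemma F_psum: "F \<otimes> psum n = \<zero>"
  by (induction n) (simp_all add: psum_0 psum_Suc r_distr m_assoc[symmetric] Fq)

lemma psum_right_null:
  assumes "y \<in> carrier R" "D \<otimes> y = \<zero>" shows "psum n \<otimes> y = \<zero>"
proof (induction n)
  case (Suc n)
  have "q \<otimes> B [^] n \<otimes> D [^] (2 * n + 1) \<otimes> y = q \<otimes> B [^] n \<otimes> D [^] (2 * n) \<otimes> (D \<otimes> y)"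
    unfolding D_odd(2) using assms by (simp add: m_assoc)
  then show ?case using Suc assms by (simp add: psum_Suc l_distr)
qed (use assms in \<open>simp add: psum_0\<close>)

text \<open>Multiplying by \<open>B\<close> on the left and by \<open>D D\<close> on the right turns
  the term of order \<open>n\<close> into that of order \<open>Suc n\<close>, as \<open>q\<close>
  commutes with \<open>B\<close>. Both sides therefore list the terms of orders \<open>0\<close> to
  \<open>n\<close>, the right side with the first one split off.\<close>

lemma psum_rec: "psum n \<oplus> q \<otimes> B [^] n \<otimes> D [^] (2 * n + 1) = q \<otimes> D \<oplus> B \<otimes> psum n \<otimes> (D \<otimes> D)"
proof (induction n)
  case (Suc n)
  have 1: "q \<otimes> B [^] Suc n = B \<otimes> (q \<otimes> B [^] n)"
    unfolding nat_pow_Suc2[OF B] by (simp add: m_assoc[symmetric] qB)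
  have 2: "D [^] (2 * Suc n + 1) = D [^] (2 * n + 1) \<otimes> (D \<otimes> D)" by (simp add: m_assoc)
  define t where "t = q \<otimes> B [^] n \<otimes> D [^] (2 * n + 1)"
  have t: "t \<in> carrier R" by (simp add: t_def del: nat_pow_Suc)
  have 3: "q \<otimes> B [^] Suc n \<otimes> D [^] (2 * Suc n + 1) = B \<otimes> t \<otimes> (D \<otimes> D)"
    unfolding 1 2 t_def by (simp add: m_assoc)
  have "psum (Suc n) \<oplus> q \<otimes> B [^] Suc n \<otimes> D [^] (2 * Suc n + 1)
    = q \<otimes> D \<oplus> B \<otimes> psum n \<otimes> (D \<otimes> D) \<oplus> B \<otimes> t \<otimes> (D \<otimes> D)"
    unfolding 3 by (simp only: psum_Suc Suc)
  also have "\<dots> = q \<otimes> D \<oplus> B \<otimes> psum (Suc n) \<otimes> (D \<otimes> D)"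
    unfolding psum_Suc t_def[symmetric] using t by (simp add: l_distr r_distr a_assoc)
  finally show ?case .
qed (simp add: psum_0)

text \<open>The boundary term vanishes because \<open>q B^l = 0\<close>. This fixed point equation
  replaces the explicit sum: \<open>DU\<close>, \<open>AU\<close>, \<open>UDA\<close>,
  \<open>UA\<close> and \<open>UU\<close> follow by unfolding it once.\<close>

lemma U_rec: "U = q \<otimes> D \<oplus> B \<otimes> U \<otimes> (D \<otimes> D)"
  using psum_rec[of l] complB(6) by (simp add: U_def)

lemma aU: "a \<otimes> U = \<zero>" and FU: "F \<otimes> U = \<zero>"
  and UB: "U \<otimes> B = \<zero>" and Ua: "U \<otimes> a = \<zero>"
  by (simp_all add: U_def a_psum F_psum psum_right_null DB Da)

lemma U_shift: "finsum R (\<lambda>i. q \<otimes> B [^] i \<otimes> D [^] (2 * i + 2)) {0..<l} = U \<otimes> D"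
  unfolding U_def psum_def
  by (subst finsum_ldistr) (auto simp: m_assoc intro!: finsum_cong')

lemma DU: "D \<otimes> U = D \<otimes> D"
proof -
  have "D \<otimes> U = D \<otimes> q \<otimes> D \<oplus> D \<otimes> B \<otimes> U \<otimes> (D \<otimes> D)"
    by (subst U_rec) (simp add: r_distr m_assoc)
  then show ?thesis by (simp add: DB Dq)
qed

text \<open>By \<open>A B = a B\<close> the correction term in \<open>A q\<close> ends in
  \<open>a\<close>, which \<open>D\<close> kills on the right, and \<open>A B U\<close> becomes
  \<open>B a U = 0\<close>.\<close>

lemma AU: "A \<otimes> U = A \<otimes> D"
proof -
  have "A \<otimes> q = A \<ominus> B \<otimes> F \<otimes> a"
    by (simp add: q_def minus_eq r_distr r_minus m_assoc[symmetric] AB flip: aBF)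
  then have 1: "A \<otimes> q \<otimes> D = A \<otimes> D" by (simp add: minus_eq l_distr l_minus m_assoc aD)
  have "A \<otimes> U = A \<otimes> q \<otimes> D \<oplus> A \<otimes> B \<otimes> U \<otimes> (D \<otimes> D)"
    by (subst U_rec) (simp add: r_distr m_assoc)
  moreover have "A \<otimes> B \<otimes> U = \<zero>" by (simp add: AB aB m_assoc aU)
  ultimately show ?thesis using 1 by simp
qed


lemma UDA: "U \<otimes> D \<otimes> A = U"
proof -
  have "U \<otimes> D \<otimes> A = q \<otimes> (D \<otimes> (D \<otimes> A)) \<oplus> B \<otimes> U \<otimes> (D \<otimes> (D \<otimes> (D \<otimes> A)))"
    by (subst U_rec) (simp add: l_distr m_assoc)
  also have "\<dots> = U" unfolding DDA by (rule U_rec[symmetric])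
  finally show ?thesis .
qed

lemma UA: "U \<otimes> A = q \<otimes> (A \<otimes> D) \<oplus> B \<otimes> U \<otimes> D"
proof -
  have "U \<otimes> A = q \<otimes> (D \<otimes> A) \<oplus> B \<otimes> U \<otimes> (D \<otimes> (D \<otimes> A))"
    by (subst U_rec) (simp add: l_distr m_assoc)
  then show ?thesis unfolding DDA by (simp only: DA)
qed

text \<open>Substituting \<open>D U = D D\<close> into the unfolded left factor leaves the unfolding
  of \<open>U\<close> with an extra factor \<open>D\<close>.\<close>

lemma UU: "U \<otimes> U = U \<otimes> D"
proof -
  have "U \<otimes> U = q \<otimes> (D \<otimes> U) \<oplus> B \<otimes> U \<otimes> (D \<otimes> (D \<otimes> U))"
    by (subst (1) U_rec) (simp add: l_distr m_assoc)
  also have "\<dots> = (q \<otimes> D \<oplus> B \<otimes> U \<otimes> (D \<otimes> D)) \<otimes> D"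
    unfolding DU by (simp add: l_distr m_assoc)
  finally show ?thesis unfolding U_rec[symmetric] .
qed

lemma pU: "p \<otimes> U = U \<ominus> D"
  by (simp add: p_def minus_eq l_distr l_minus m_assoc DU ADD)

lemma q_AD: "q \<otimes> (A \<otimes> D) = A \<otimes> D \<ominus> B \<otimes> F \<otimes> (A \<otimes> D)"
  by (simp add: q_def minus_eq l_distr l_minus)

lemma Fp: "F \<otimes> p = F \<ominus> F \<otimes> (A \<otimes> D)"
  by (simp add: p_def minus_eq r_distr r_minus)

lemma FpA: "F \<otimes> p \<otimes> A = a \<otimes> F"
  by (simp only: aF, simp add: a_def complA(3) m_assoc)

section \<open>Blocks of \<open>N X\<close>, \<open>X N\<close>, \<open>X N X\<close> and
  \<open>N (I - N X)\<close> for the claimed inverse \<open>X\<close>\<close>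

definition "w = U \<otimes> A \<oplus> B \<otimes> F"

lemma w_closed [simp]: "w \<in> carrier R" by (simp add: w_def)

text \<open>\<open>w\<close> is the upper left block of \<open>N X\<close>. \<open>block11\<close>
  and \<open>block12\<close> give the first row of \<open>N X\<close>, \<open>block21\<close> and
  \<open>block22\<close> the second row of \<open>X N\<close>; the other blocks are immediate or
  come from \<open>w_def\<close> and \<open>UB\<close>.\<close>

lemma block11: "A \<otimes> U \<oplus> B \<otimes> (U \<otimes> D \<oplus> F \<otimes> p) = w"
proof -
  have "A \<otimes> U \<oplus> B \<otimes> (U \<otimes> D \<oplus> F \<otimes> p)
    = A \<otimes> D \<oplus> (B \<otimes> U \<otimes> D \<oplus> (B \<otimes> F \<ominus> B \<otimes> F \<otimes> (A \<otimes> D)))"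
    by (simp add: AU Fp r_distr minus_eq r_minus m_assoc)
  also have "\<dots> = (A \<otimes> D \<ominus> B \<otimes> F \<otimes> (A \<otimes> D) \<oplus> B \<otimes> U \<otimes> D) \<oplus> B \<otimes> F"
    by (simp add: minus_eq a_ac)
  finally show ?thesis by (simp add: w_def UA q_AD)
qed

lemma block12: "A \<otimes> (B \<otimes> F) \<oplus> B \<otimes> (\<ominus> (a \<otimes> F)) = \<zero>"
  by (simp add: m_assoc[symmetric] AB aB r_minus r_neg)

lemma block21: "(U \<otimes> D \<oplus> F \<otimes> p) \<otimes> A \<oplus> \<ominus> (a \<otimes> F) = U"
  by (simp add: l_distr UDA FpA a_assoc r_neg)

lemma block22: "(U \<otimes> D \<oplus> F \<otimes> p) \<otimes> B = B \<otimes> F"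
  by (simp add: l_distr m_assoc DB pB FB)

text \<open>Together with \<open>idem21\<close> and \<open>idem22\<close> this is the block form of
  \<open>X (N X) = X\<close>.\<close>

lemma idem11: "U \<otimes> w \<oplus> B \<otimes> F \<otimes> U = U"
proof -
  have "U \<otimes> w = U \<otimes> U \<otimes> A \<oplus> U \<otimes> B \<otimes> F"
    by (simp add: w_def r_distr m_assoc)
  then show ?thesis by (simp add: UU UDA UB m_assoc FU)
qed

lemma idem21: "(U \<otimes> D \<oplus> F \<otimes> p) \<otimes> w \<oplus> \<ominus> (a \<otimes> F) \<otimes> U = U \<otimes> D \<oplus> F \<otimes> p"
proof -
  have 1: "U \<otimes> D \<otimes> w = U \<otimes> D"
  proof -
    have "U \<otimes> D \<otimes> w = U \<otimes> (D \<otimes> U) \<otimes> A \<oplus> U \<otimes> (D \<otimes> B) \<otimes> F"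
      by (simp add: w_def r_distr m_assoc)
    also have "\<dots> = U \<otimes> D \<otimes> (D \<otimes> A)" by (simp add: DU DB m_assoc)
    also have "\<dots> = U \<otimes> D" by (simp add: m_assoc DDA)
    finally show ?thesis .
  qed
  have 2: "F \<otimes> p \<otimes> w = F \<otimes> p"
  proof -
    have "F \<otimes> p \<otimes> w = F \<otimes> (p \<otimes> U) \<otimes> A \<oplus> F \<otimes> (p \<otimes> B) \<otimes> F"
      by (simp add: w_def r_distr m_assoc)
    also have "\<dots> = F \<otimes> U \<otimes> A \<ominus> F \<otimes> (A \<otimes> D) \<oplus> F \<otimes> B \<otimes> F"
      unfolding pU pB by (simp add: minus_eq l_distr r_distr l_minus r_minus m_assoc DA)
    also have "F \<otimes> B \<otimes> F = F" using BF by (simp add: drazin_def)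
    finally show ?thesis by (simp add: FU Fp minus_eq a_comm)
  qed
  show ?thesis by (simp add: l_distr 1 2 l_minus m_assoc FU)
qed

lemma idem22: "\<ominus> (a \<otimes> F) \<otimes> (B \<otimes> F) = \<ominus> (a \<otimes> F)" "B \<otimes> F \<otimes> (B \<otimes> F) = B \<otimes> F"
  using idemB(4) idemB(2) by (simp_all add: l_minus m_assoc)

text \<open>The upper left block of \<open>N (I - N X)\<close>. Here \<open>A w\<close> splits into
  the core part \<open>A A D\<close> and \<open>a B F\<close>; removing the first from
  \<open>A\<close> leaves \<open>a\<close>, removing the second leaves \<open>a q\<close>.\<close>

lemma compl11: "A \<otimes> (\<one> \<ominus> w) \<oplus> B \<otimes> (\<ominus> U) = a \<otimes> q \<ominus> B \<otimes> U"
proof -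
  have "A \<otimes> w = A \<otimes> (A \<otimes> D) \<oplus> a \<otimes> (B \<otimes> F)"
    using idemA(5) by (simp add: w_def r_distr m_assoc[symmetric] AU AB)
  moreover have "a = A \<ominus> A \<otimes> (A \<otimes> D)" by (simp add: a_def p_def minus_eq r_distr r_minus)
  moreover have "a \<otimes> q = a \<ominus> a \<otimes> (B \<otimes> F)" by (simp add: q_def minus_eq r_distr r_minus)
  ultimately have "A \<otimes> (\<one> \<ominus> w) = a \<otimes> q"
    by (simp add: minus_eq r_distr r_minus minus_add a_assoc)
  then show ?thesis by (simp add: minus_eq r_minus)
qed

lemma compl21: "\<one> \<ominus> w = q \<ominus> U \<otimes> A"
  by (simp add: w_def q_def minus_eq minus_add a_ac)

text \<open>These products make the summand \<open>M2\<close> of \<open>N (I - N X)\<close>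
  annihilate the whole from the left. \<open>U\<close> kills \<open>a\<close> and \<open>B\<close>
  on its right, and so does \<open>U A\<close>, because \<open>a\<close> commutes with
  \<open>A\<close> and \<open>A B = a B\<close>.\<close>

lemma U_null: "U \<otimes> (a \<otimes> q \<ominus> B \<otimes> U) = \<zero>" "U \<otimes> (B \<otimes> q) = \<zero>"
  "U \<otimes> A \<otimes> (a \<otimes> q \<ominus> B \<otimes> U) = \<zero>" "U \<otimes> A \<otimes> (B \<otimes> q) = \<zero>"
proof -
  have 1: "U \<otimes> A \<otimes> a = \<zero>" "U \<otimes> A \<otimes> B = \<zero>"
    by (simp add: m_assoc aA[symmetric], simp add: m_assoc[symmetric] Ua)
      (simp add: m_assoc AB, simp add: m_assoc[symmetric] Ua)
  show "U \<otimes> (a \<otimes> q \<ominus> B \<otimes> U) = \<zero>" "U \<otimes> (B \<otimes> q) = \<zero>"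
    by (simp_all add: minus_eq r_distr r_minus m_assoc[symmetric] Ua UB)
  show "U \<otimes> A \<otimes> (a \<otimes> q \<ominus> B \<otimes> U) = \<zero>" "U \<otimes> A \<otimes> (B \<otimes> q) = \<zero>"
    using 1 by (simp_all add: minus_eq r_distr r_minus m_assoc[symmetric])
qed

lemma a_nilpotent: "a [^] Suc k = \<zero>" and Bq_nilpotent: "(B \<otimes> q) [^] Suc l = \<zero>"
  by (simp_all only: a_def complA(8) complB(8))

lemma q_Bq: "q \<otimes> (B \<otimes> q) = B \<otimes> q" "B \<otimes> q \<otimes> q = B \<otimes> q"
  by (simp add: m_assoc[symmetric] qB, simp add: m_assoc qq) (simp add: m_assoc qq)

lemma a_Bq: "a \<otimes> (B \<otimes> q) = B \<otimes> q \<otimes> a"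
  by (simp add: m_assoc[symmetric] aB, simp add: m_assoc aq)

end

section \<open>Column spaces and rank\<close>

text \<open>A basis of the smaller space stays linearly independent in the larger one and, by the
  dimension count, is a basis there as well.\<close>

lemma (in vectorspace) subspace_eqI_dim:
  assumes W: "subspace K W V" "vectorspace.fin_dim K (vs W)"
    and X: "subspace K X V" "vectorspace.fin_dim K (vs X)"
    and sub: "X \<subseteq> W" and dim: "vectorspace.dim K (vs W) \<le> vectorspace.dim K (vs X)"
  shows "X = W"
proof -
  interpret X: vectorspace K "vs X" using X(1) by (rule subspace_is_vs)
  interpret W: vectorspace K "vs W" using W(1) by (rule subspace_is_vs)
  have sX: "submodule K X V" and sW: "submodule K W V" using X(1) W(1) by (auto simp: subspace_def)
  obtain b where fin: "finite b" and b: "X.basis b"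
    using X.finite_basis_exists[OF X(2)] by blast
  have bX: "b \<subseteq> X" "X.lin_indpt b" "X.span b = X" using b by (auto simp: X.basis_def)
  have bW: "b \<subseteq> W" using bX(1) sub by blast
  have "W.lin_indpt b"
    using bX(2) span_li_not_depend(2)[OF bX(1) sX] span_li_not_depend(2)[OF bW sW] by simp
  moreover have "W.dim \<le> card b" using dim X.dim_basis[OF fin b] by simp
  ultimately have "W.basis b" using W.dim_li_is_basis[OF W(2) fin] bW by simp
  then have "W.span b = W" by (simp add: W.basis_def)
  then show ?thesis
    using bX(3) span_li_not_depend(1)[OF bX(1) sX] span_li_not_depend(1)[OF bW sW] by simp
qed

context vec_space
begin

lemma col_space_mult_subset:
  assumes "M \<in> carrier_mat n n" "Y \<in> carrier_mat n n"
  shows "col_space (M * Y) \<subseteq> col_space M"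
proof
  fix y assume "y \<in> col_space (M * Y)"
  then obtain x where x: "x \<in> carrier_vec n" "y = M * Y *\<^sub>v x"
    using assms by (auto simp: col_space_eq[where nc = n])
  then have "y = M *\<^sub>v (Y *\<^sub>v x)" using assms by (simp add: assoc_mult_mat_vec[where n\<^sub>2 = n])
  then show "y \<in> col_space M" using assms x(1) by (auto simp: col_space_eq[where nc = n])
qed

lemma subspace_col_space:
  assumes "M \<in> carrier_mat n n"
  shows "subspace class_ring (col_space M) V" "vectorspace.fin_dim class_ring (vs (col_space M))"
proof -
  have "set (cols M) \<subseteq> carrier_vec n" using assms cols_dim[of M] by simp
  then show "subspace class_ring (col_space M) V" "vectorspace.fin_dim class_ring (vs (col_space M))"
    unfolding col_space_def using fin_dim_span_cols[OF assms] by (auto intro: span_is_subspace)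
qed

lemma rank_col_space: "rank M = vectorspace.dim class_ring (vs (col_space M))"
  by (simp add: rank_def col_space_def)

lemma rank_mult_le:
  assumes "M \<in> carrier_mat n n" "Y \<in> carrier_mat n n"
  shows "rank (M * Y) \<le> rank M"
proof -
  have MY: "M * Y \<in> carrier_mat n n" using assms by simp
  interpret W: vectorspace class_ring "vs (col_space M)"
    using subspace_col_space(1)[OF assms(1)] by (rule subspace_is_vs)
  have "subspace class_ring (col_space (M * Y)) (vs (col_space M))"
    using nested_subspaces[OF subspace_col_space(1)[OF assms(1)] subspace_col_space(1)[OF MY]
        col_space_mult_subset[OF assms]] .
  then show ?thesis
    using W.subspace_dim[of "col_space (M * Y)"] subspace_col_space(2)[OF assms(1)]
      subspace_col_space(2)[OF MY] by (simp add: rank_col_space)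
qed

lemma rank_mult_eqD:
  assumes M: "M \<in> carrier_mat n n" and Y: "Y \<in> carrier_mat n n" and rank: "rank (M * Y) = rank M"
  shows "\<exists>Z \<in> carrier_mat n n. M = M * Y * Z"
proof -
  have MY: "M * Y \<in> carrier_mat n n" using assms by simp
  have eq: "col_space (M * Y) = col_space M"
    by (rule subspace_eqI_dim[OF subspace_col_space[OF M] subspace_col_space[OF MY]
        col_space_mult_subset[OF M Y]]) (use rank in \<open>simp add: rank_col_space\<close>)
  have "\<exists>x \<in> carrier_vec n. M * Y *\<^sub>v x = col M j" if "j < n" for j
  proof -
    have "col M j \<in> col_space M"
      unfolding col_space_eq[OF M] using M that col_mult2[OF M one_carrier_mat that]
      by (auto intro!: bexI[of _ "col (1\<^sub>m n) j"])
    then show ?thesis unfolding eq[symmetric] using M Y by (auto simp: col_space_eq[OF MY])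
  qed
  then obtain z where z: "\<And>j. j < n \<Longrightarrow> z j \<in> carrier_vec n \<and> M * Y *\<^sub>v z j = col M j" by metis
  \<comment> \<open>Equal column spaces give each column of \<open>M\<close> a preimage under
    \<open>M Y\<close>; these preimages are the columns of \<open>Z\<close>.\<close>
  define Z where "Z = mat_of_cols n (map z [0..<n])"
  have Z: "Z \<in> carrier_mat n n" by (simp add: Z_def carrier_matI)
  have "col (M * Y * Z) j = col M j" if "j < n" for j
  proof -
    have "col Z j = z j" using that z by (simp add: Z_def)
    then show ?thesis unfolding col_mult2[OF MY Z that] using z[OF that] by simp
  qed
  then have "M = M * Y * Z" using M MY Z by (intro mat_col_eqI) auto
  then show ?thesis using Z by blast
qed

end

section \<open>Existence of complex and dual Drazin inverses\<close>

lemma is_drazin_inverse_iff: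
  fixes A :: "'a::comm_ring_1 mat"
  assumes "A \<in> carrier_mat n n"
  shows "is_drazin_inverse k A X \<longleftrightarrow> monoid.drazin (ring_mat TYPE('a) n ()) k A X"
proof -
  interpret ring "ring_mat TYPE('a) n ()" by (rule ring_mat)
  show ?thesis
    using assms by (simp add: is_drazin_inverse_def drazin_def ring_mat_simps pow_mat_ring_pow[OF assms, of _ "()"])
qed

lemma is_drazin_inverse_unique:
  fixes A :: "'a::comm_ring_1 mat"
  assumes A: "A \<in> carrier_mat n n" and "is_drazin_inverse k A X" "is_drazin_inverse l A Y"
  shows "X = Y"
proof -
  interpret ring "ring_mat TYPE('a) n ()" by (rule ring_mat)
  show ?thesis
    using assms drazin_unique[of A k X l Y] by (simp add: is_drazin_inverse_iff[OF A] ring_mat_simps)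
qed

section \<open>Existence of Drazin inverses over a field\<close>

lemma rank_pow_stationary:
  fixes A :: "'a::field mat"
  assumes A: "A \<in> carrier_mat n n"
  shows "\<exists>k. vec_space.rank n (A ^\<^sub>m k) = vec_space.rank n (A ^\<^sub>m (k + 1))"
proof (rule ccontr)
  let ?r = "\<lambda>k. vec_space.rank n (A ^\<^sub>m k)"
  assume "\<not> ?thesis"
  moreover have "?r (k + 1) \<le> ?r k" for k
    using vec_space.rank_mult_le[of "A ^\<^sub>m k" n A] A by (simp add: pow_carrier_mat)
  ultimately have "?r (k + 1) < ?r k" for k by (metis order_le_imp_less_or_eq)
  \<comment> \<open>A strict drop at every exponent costs at least one unit of rank each time, which
    is impossible for more than \<open>?r 0\<close> steps.\<close>
  then have "?r k + k \<le> ?r 0" for k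
  proof (induction k)
    case (Suc k)
    from Suc.IH[OF Suc.prems] Suc.prems[of k] show ?case by simp
  qed simp
  from this[of "Suc (?r 0)"] show False by simp
qed

lemma rank_pow_eqD:
  fixes A :: "'a::field mat"
  assumes A: "A \<in> carrier_mat n n"
    and "vec_space.rank n (A ^\<^sub>m k) = vec_space.rank n (A ^\<^sub>m (k + 1))"
  obtains Z where "Z \<in> carrier_mat n n" "A ^\<^sub>m k = A ^\<^sub>m Suc k * Z"
  using vec_space.rank_mult_eqD[of "A ^\<^sub>m k" n A] assms by (auto simp: pow_carrier_mat)

text \<open>Transposition turns right factorizations of powers, which column spaces yield, into left
  ones.\<close>

lemma transpose_pow_mat:
  fixes A :: "'a::comm_semiring_1 mat"
  assumes A: "A \<in> carrier_mat n n"
  shows "(A ^\<^sub>m k)\<^sup>T = A\<^sup>T ^\<^sub>m k"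
proof (induction k)
  case (Suc k)
  have "A ^\<^sub>m Suc k = A * A ^\<^sub>m k"
    by (induction k) (use A in \<open>simp_all add: assoc_mult_mat[of _ n n _ n _ n] pow_carrier_mat\<close>)
  then show ?case using A Suc by (simp add: transpose_mult[of _ n n _ n] pow_carrier_mat)
qed (use A in simp)

text \<open>The rank condition yields a right factorization at \<open>k\<close>. A left one comes,
  at some unrelated exponent \<open>l\<close>, from the stationary ranks of the powers of the
  transpose. Both hold at the maximum \<open>m\<close>, and the inverse found there has its index
  lowered to \<open>k\<close>.\<close>

lemma drazin_inverse_exists:
  fixes A :: "'a::field mat"
  assumes A: "A \<in> carrier_mat n n"
    and rank: "vec_space.rank n (A ^\<^sub>m k) = vec_space.rank n (A ^\<^sub>m (k + 1))"
  shows "\<exists>X. is_drazin_inverse k A X"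
proof -
  let ?R = "ring_mat TYPE('a) n ()"
  interpret ring ?R by (rule ring_mat)
  note pow = pow_mat_ring_pow[OF A, of _ "()"]
  have Ac: "A \<in> carrier ?R" using A by (simp add: ring_mat_simps)
  obtain Z where Z: "Z \<in> carrier_mat n n" "A ^\<^sub>m k = A ^\<^sub>m Suc k * Z"
    using rank_pow_eqD[OF A rank] .
  have AT: "A\<^sup>T \<in> carrier_mat n n" using A by simp
  obtain l where "vec_space.rank n (A\<^sup>T ^\<^sub>m l) = vec_space.rank n (A\<^sup>T ^\<^sub>m (l + 1))"
    using rank_pow_stationary[OF AT] by blast
  then obtain Y where Y: "Y \<in> carrier_mat n n" "A\<^sup>T ^\<^sub>m l = A\<^sup>T ^\<^sub>m Suc l * Y"
    using rank_pow_eqD[OF AT] by blast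
  have "A ^\<^sub>m l = (A\<^sup>T ^\<^sub>m Suc l * Y)\<^sup>T"
    using Y(2) transpose_pow_mat[OF A] by (metis transpose_transpose)
  also have "\<dots> = Y\<^sup>T * A ^\<^sub>m Suc l"
    using AT Y(1) by (simp only: transpose_mult[of _ n n _ n] pow_carrier_mat transpose_pow_mat[OF AT] transpose_transpose)
  finally have left: "A ^\<^sub>m l = Y\<^sup>T * A ^\<^sub>m Suc l" .
  define m where "m = max k l"
  obtain i where m: "m = i + k" unfolding m_def by (metis le_Suc_ex add.commute max.cobounded1)
  obtain j where m': "m = l + j" unfolding m_def by (metis le_Suc_ex max.cobounded2)
  have carr: "Z \<in> carrier ?R" "Y\<^sup>T \<in> carrier ?R" using Z(1) Y(1) by (simp_all add: ring_mat_simps)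
  have Zk: "A [^]\<^bsub>?R\<^esub> k = A [^]\<^bsub>?R\<^esub> Suc k \<otimes>\<^bsub>?R\<^esub> Z"
    using Z(2) unfolding pow ring_mat_simps .
  have R: "A [^]\<^bsub>?R\<^esub> m = A [^]\<^bsub>?R\<^esub> Suc m \<otimes>\<^bsub>?R\<^esub> Z"
  proof -
    have "A [^]\<^bsub>?R\<^esub> m = A [^]\<^bsub>?R\<^esub> i \<otimes>\<^bsub>?R\<^esub> A [^]\<^bsub>?R\<^esub> k"
      using Ac by (simp add: nat_pow_mult m)
    also note Zk
    also have "A [^]\<^bsub>?R\<^esub> i \<otimes>\<^bsub>?R\<^esub> (A [^]\<^bsub>?R\<^esub> Suc k \<otimes>\<^bsub>?R\<^esub> Z) = A [^]\<^bsub>?R\<^esub> (i + Suc k) \<otimes>\<^bsub>?R\<^esub> Z"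
      using Ac carr by (simp add: nat_pow_mult[symmetric] m_assoc del: nat_pow_Suc)
    finally show ?thesis by (simp only: m add_Suc_right)
  qed
  have L: "A [^]\<^bsub>?R\<^esub> m = Y\<^sup>T \<otimes>\<^bsub>?R\<^esub> A [^]\<^bsub>?R\<^esub> Suc m"
  proof -
    have "A [^]\<^bsub>?R\<^esub> m = A [^]\<^bsub>?R\<^esub> l \<otimes>\<^bsub>?R\<^esub> A [^]\<^bsub>?R\<^esub> j"
      using Ac by (simp add: nat_pow_mult m')
    also have "A [^]\<^bsub>?R\<^esub> l = Y\<^sup>T \<otimes>\<^bsub>?R\<^esub> A [^]\<^bsub>?R\<^esub> Suc l"
      using left unfolding pow ring_mat_simps .
    also have "Y\<^sup>T \<otimes>\<^bsub>?R\<^esub> A [^]\<^bsub>?R\<^esub> Suc l \<otimes>\<^bsub>?R\<^esub> A [^]\<^bsub>?R\<^esub> j = Y\<^sup>T \<otimes>\<^bsub>?R\<^esub> A [^]\<^bsub>?R\<^esub> (Suc l + j)"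
      using Ac carr by (simp add: nat_pow_mult[symmetric] m_assoc del: nat_pow_Suc add_Suc)
    finally show ?thesis by (simp only: m' add_Suc)
  qed
  obtain X where X: "drazin m A X"
    using drazin_exists[OF Ac carr R L] by blast
  have "drazin k A X"
    by (rule drazin_lower_index[OF Ac X carr(1) Zk])
  then show ?thesis using is_drazin_inverse_iff[OF A] by blast
qed

lemma drazin_inverse_complex:
  assumes A: "A \<in> carrier_mat n n"
  shows "is_drazin_inverse (Ind A) A (drazin_inverse A)"
proof -
  have "vec_space.rank n (A ^\<^sub>m Ind A) = vec_space.rank n (A ^\<^sub>m (Ind A + 1))"
    unfolding Ind_def using LeastI_ex[OF rank_pow_stationary[OF A]] A by simp
  then obtain X where X: "is_drazin_inverse (Ind A) A X" using drazin_inverse_exists[OF A] by blast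
  show ?thesis
    unfolding drazin_inverse_def by (rule theI, rule X) (rule is_drazin_inverse_unique[OF A _ X])
qed

section \<open>Lifting Drazin inverses from complex to dual matrices\<close>

context ring
begin

text \<open>
  With \<open>x = a + \<epsilon> b\<close> and \<open>x\<^sup>j = a\<^sup>j + \<epsilon> s\<^sub>j\<close>, the two conclusions are the \<open>\<epsilon>\<close>-parts of
  \<open>x\<^sup>k\<^sup>+\<^sup>1 (d + \<epsilon> v) = x\<^sup>k\<close> and \<open>(d + \<epsilon> w) x\<^sup>k\<^sup>+\<^sup>1 = x\<^sup>k\<close>.
\<close>

lemma infinitesimal_pi_regular:
  assumes a: "a \<in> carrier R" and d: "drazin k a d"
    and b: "b \<in> carrier R" and s: "s \<in> carrier R"
    and t1: "t = a \<otimes> s \<oplus> b \<otimes> a [^] k" and t2: "t = s \<otimes> a \<oplus> a [^] k \<otimes> b"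
    and psp: "(\<one> \<ominus> a \<otimes> d) \<otimes> s \<otimes> (\<one> \<ominus> a \<otimes> d) = \<zero>"
  shows "\<exists>v \<in> carrier R. a [^] Suc k \<otimes> v \<oplus> t \<otimes> d = s"
    and "\<exists>w \<in> carrier R. w \<otimes> a [^] Suc k \<oplus> d \<otimes> t = s"
proof -
  define p where "p = \<one> \<ominus> a \<otimes> d"
  note E = drazin_idem[OF a d]
  note P = drazin_complement[OF a d, folded p_def]
  have dc: "d \<in> carrier R" and ad: "a \<otimes> d = d \<otimes> a" using d by (auto simp: drazin_def)
  have t: "t \<in> carrier R" using t1 a b s by simp
  have psp: "p \<otimes> s \<otimes> p = \<zero>" using psp by (simp add: p_def)
  \<comment> \<open>\<open>p\<close> is the complement of \<open>a d\<close>, so being annihilated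
    by \<open>p\<close> means being fixed by \<open>a d\<close>.\<close>
  have absorb_left: "a \<otimes> d \<otimes> y = y" if "y \<in> carrier R" "p \<otimes> y = \<zero>" for y
    using that a dc E(1) by (simp add: p_def minus_eq l_distr l_minus)
      (metis a_inv_closed m_closed minus_equality minus_minus)
  have absorb_right: "y \<otimes> (a \<otimes> d) = y" if "y \<in> carrier R" "y \<otimes> p = \<zero>" for y
    using that a dc E(1) by (simp add: p_def minus_eq r_distr r_minus)
      (metis a_inv_closed m_closed minus_equality minus_minus)
  have pow: "a [^] Suc k \<otimes> d [^] Suc k = a \<otimes> d" "d [^] Suc k \<otimes> a [^] Suc k = a \<otimes> d"
  proof -
    show 1: "a [^] Suc k \<otimes> d [^] Suc k = a \<otimes> d" by (rule E(8))
    have "a \<otimes> d [^] Suc k = d [^] Suc k \<otimes> a" by (rule pow_commute[OF dc a ad])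
    then show "d [^] Suc k \<otimes> a [^] Suc k = a \<otimes> d"
      using pow_commute[OF a, of "d [^] Suc k" "Suc k"] dc 1 by (simp only: nat_pow_closed)
  qed
  have esp: "p \<otimes> s \<otimes> (a \<otimes> d) = p \<otimes> s"
    by (rule absorb_right) (use P(1) s psp in auto)
  have spe: "a \<otimes> d \<otimes> (s \<otimes> p) = s \<otimes> p"
    by (rule absorb_left) (use P(1) s psp in \<open>auto simp: m_assoc\<close>)
  show "\<exists>v \<in> carrier R. a [^] Suc k \<otimes> v \<oplus> t \<otimes> d = s"
  proof
    \<comment> \<open>As \<open>p a^k = 0\<close>, the form \<open>t2\<close> leaves
      \<open>p t = p s a\<close>. Thus \<open>s - t d\<close> is annihilated by \<open>p\<close>,
      hence fixed by \<open>a d = a^(k+1) d^(k+1)\<close>, which gives the witness. The second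
      conclusion is the mirror image, with \<open>t1\<close>.\<close>
    have "p \<otimes> t = p \<otimes> s \<otimes> a \<oplus> p \<otimes> a [^] k \<otimes> b"
      using t2 P(1) a b s by (simp add: r_distr m_assoc)
    then have "p \<otimes> t \<otimes> d = p \<otimes> s \<otimes> (a \<otimes> d)" using P(1,6) a b s dc by (simp add: m_assoc)
    then have "p \<otimes> (s \<ominus> t \<otimes> d) = \<zero>"
      using esp P(1) s t dc by (simp add: minus_eq r_distr r_minus m_assoc r_neg)
    then have "a \<otimes> d \<otimes> (s \<ominus> t \<otimes> d) = s \<ominus> t \<otimes> d"
      using s t dc by (intro absorb_left) auto
    then have "a [^] Suc k \<otimes> (d [^] Suc k \<otimes> (s \<ominus> t \<otimes> d)) = s \<ominus> t \<otimes> d"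
      using pow(1) a dc s t by (metis m_assoc m_closed minus_closed nat_pow_closed)
    then show "a [^] Suc k \<otimes> (d [^] Suc k \<otimes> (s \<ominus> t \<otimes> d)) \<oplus> t \<otimes> d = s"
      using s t dc by (simp add: minus_eq a_assoc l_neg)
  qed (use dc s t in auto)
  show "\<exists>w \<in> carrier R. w \<otimes> a [^] Suc k \<oplus> d \<otimes> t = s"
  proof
    have "t \<otimes> p = a \<otimes> (s \<otimes> p) \<oplus> b \<otimes> (a [^] k \<otimes> p)"
      using t1 P(1) a b s by (simp add: l_distr m_assoc)
    then have "d \<otimes> (t \<otimes> p) = a \<otimes> d \<otimes> (s \<otimes> p)" using P(1,7) a b s dc by (simp add: m_assoc ad)
    then have "(s \<ominus> d \<otimes> t) \<otimes> p = \<zero>"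
      using spe P(1) s t dc by (simp add: minus_eq l_distr l_minus m_assoc r_neg)
    then have "(s \<ominus> d \<otimes> t) \<otimes> (a \<otimes> d) = s \<ominus> d \<otimes> t"
      using s t dc by (intro absorb_right) auto
    then have "(s \<ominus> d \<otimes> t) \<otimes> d [^] Suc k \<otimes> a [^] Suc k = s \<ominus> d \<otimes> t"
      using pow(2) a dc s t by (metis m_assoc m_closed minus_closed nat_pow_closed)
    then show "(s \<ominus> d \<otimes> t) \<otimes> d [^] Suc k \<otimes> a [^] Suc k \<oplus> d \<otimes> t = s"
      using s t dc by (simp add: minus_eq a_assoc l_neg)
  qed (use dc s t in auto)
qed

text \<open>The sum is the infinitesimal coefficient of \<open>(a + \<epsilon> b)^k\<close>, and the
  recurrence is the product rule for splitting off one factor on the left.\<close>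

lemma derivation_pow_Suc:
  assumes a: "a \<in> carrier R" and b: "b \<in> carrier R"
  shows "(\<Oplus>i\<in>{1..Suc k}. a [^] (Suc k - i) \<otimes> b \<otimes> a [^] (i - 1))
    = a \<otimes> (\<Oplus>i\<in>{1..k}. a [^] (k - i) \<otimes> b \<otimes> a [^] (i - 1)) \<oplus> b \<otimes> a [^] k"
proof -
  have "(\<Oplus>i\<in>{1..k}. a [^] (Suc k - i) \<otimes> b \<otimes> a [^] (i - 1))
    = (\<Oplus>i\<in>{1..k}. a \<otimes> (a [^] (k - i) \<otimes> b \<otimes> a [^] (i - 1)))"
  proof (rule finsum_cong')
    fix i assume "i \<in> {1..k}"
    then have "a [^] (Suc k - i) = a \<otimes> a [^] (k - i)"
      using nat_pow_Suc2[OF a, of "k - i"] by (simp add: Suc_diff_le)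
    then show "a [^] (Suc k - i) \<otimes> b \<otimes> a [^] (i - 1) = a \<otimes> (a [^] (k - i) \<otimes> b \<otimes> a [^] (i - 1))"
      using a b by (simp add: m_assoc)
  qed (use a b in auto)
  also have "\<dots> = a \<otimes> (\<Oplus>i\<in>{1..k}. a [^] (k - i) \<otimes> b \<otimes> a [^] (i - 1))"
    using a b by (subst finsum_rdistr) auto
  finally have 1: "(\<Oplus>i\<in>{1..k}. a [^] (Suc k - i) \<otimes> b \<otimes> a [^] (i - 1)) = \<dots>" .
  have "{1..Suc k} = insert (Suc k) {1..k}" by auto
  then show ?thesis
    using a b 1 finsum_closed[of "\<lambda>i. a [^] (k - i) \<otimes> b \<otimes> a [^] (i - 1)" "{1..k}"]
    by (simp add: Pi_def a_comm)
qed

end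

lemma ring_mat_uminus:
  fixes X :: "'a::comm_ring_1 mat"
  assumes "X \<in> carrier_mat n n"
  shows "\<ominus>\<^bsub>ring_mat TYPE('a) n b\<^esub> X = - X"
proof -
  interpret ring "ring_mat TYPE('a) n b" by (rule ring_mat)
  show ?thesis by (rule minus_equality) (use assms in \<open>simp_all add: ring_mat_simps\<close>)
qed

lemma ring_mat_minus:
  fixes X :: "'a::comm_ring_1 mat"
  assumes "X \<in> carrier_mat n n" "Y \<in> carrier_mat n n"
  shows "X \<ominus>\<^bsub>ring_mat TYPE('a) n b\<^esub> Y = X - Y"
  using assms by (simp add: a_minus_def ring_mat_uminus ring_mat_simps add_uminus_minus_mat)

text \<open>Both records carry the same additive monoid, and \<open>finsum\<close> depends on
  nothing else.\<close>

lemma msum_eq_finsum: "msum n F I = finsum (ring_mat TYPE('a::semiring_1) n b) F I"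
  by (simp add: msum_def finsum_def finprod_def ring_mat_def module_mat_def)

lemma std_part_simps [simp]:
  "std_part 0 = 0" "std_part 1 = 1" "std_part (x + y) = std_part x + std_part y"
  "std_part (x * y) = std_part x * std_part y"
  by (simp_all add: zero_dual_complex_def one_dual_complex_def plus_dual_complex_def times_dual_complex_def)

lemma inf_part_simps [simp]:
  "inf_part 0 = 0" "inf_part 1 = 0" "inf_part (x + y) = inf_part x + inf_part y"
  "inf_part (x * y) = std_part x * inf_part y + inf_part x * std_part y"
  by (simp_all add: zero_dual_complex_def one_dual_complex_def plus_dual_complex_def times_dual_complex_def)

lemma std_part_sum: "std_part (sum f I) = (\<Sum>i\<in>I. std_part (f i))"
  and inf_part_sum: "inf_part (sum f I) = (\<Sum>i\<in>I. inf_part (f i))"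
  by (induction I rule: infinite_finite_induct) simp_all

lemma std_mat_mult:
  assumes "X \<in> carrier_mat n n" "Y \<in> carrier_mat n n"
  shows "std_mat (X * Y) = std_mat X * std_mat Y"
  using assms by (auto intro!: eq_matI simp: scalar_prod_def std_part_sum)

lemma inf_mat_mult:
  assumes "X \<in> carrier_mat n n" "Y \<in> carrier_mat n n"
  shows "inf_mat (X * Y) = std_mat X * inf_mat Y + inf_mat X * std_mat Y"
  using assms by (auto intro!: eq_matI simp: scalar_prod_def inf_part_sum sum.distrib)

lemma std_mat_one: "std_mat (1\<^sub>m n) = 1\<^sub>m n" and inf_mat_one: "inf_mat (1\<^sub>m n) = 0\<^sub>m n n"
  by (auto intro!: eq_matI)

lemma std_mat_pow:
  assumes "X \<in> carrier_mat n n"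
  shows "std_mat (X ^\<^sub>m k) = std_mat X ^\<^sub>m k"
  by (induction k) (use assms in \<open>simp_all add: std_mat_one std_mat_mult[of _ n] pow_carrier_mat\<close>)

lemma dual_mat_eqI:
  assumes "X \<in> carrier_mat n n" "Y \<in> carrier_mat n n" "std_mat X = std_mat Y" "inf_mat X = inf_mat Y"
  shows "X = Y"
proof (rule eq_matI)
  fix i j assume "i < dim_row Y" "j < dim_col Y"
  moreover have "std_mat X $$ (i, j) = std_mat Y $$ (i, j)" "inf_mat X $$ (i, j) = inf_mat Y $$ (i, j)"
    using assms(3,4) by simp_all
  ultimately show "X $$ (i, j) = Y $$ (i, j)"
    using assms(1,2) by (simp add: dual_complex.expand)
qed (use assms in auto)

lemma dual_mat_exists:
  assumes "X \<in> carrier_mat n n" "Y \<in> carrier_mat n n"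
  obtains Z where "Z \<in> carrier_mat n n" "std_mat Z = X" "inf_mat Z = Y"
proof
  let ?Z = "mat n n (\<lambda>ij. Dual (X $$ ij) (Y $$ ij))"
  show "?Z \<in> carrier_mat n n" "std_mat ?Z = X" "inf_mat ?Z = Y"
    using assms by (auto intro!: eq_matI)
qed

text \<open>Explains the sum in \<open>DCz\<close>: it is the infinitesimal part of the power at the
  index, so the condition says that this part vanishes between the complementary projectors.\<close>

lemma inf_mat_pow:
  assumes "X \<in> carrier_mat n n"
  shows "inf_mat (X ^\<^sub>m k)
    = msum n (\<lambda>i. std_mat X ^\<^sub>m (k - i) * inf_mat X * std_mat X ^\<^sub>m (i - 1)) {1..k}"
proof (induction k)
  case 0
  interpret ring "ring_mat TYPE(complex) n ()" by (rule ring_mat)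
  show ?case using assms by (simp add: inf_mat_one msum_eq_finsum[where b = "()"] ring_mat_simps)
next
  case (Suc k)
  let ?R = "ring_mat TYPE(complex) n ()"
  interpret R: ring ?R by (rule ring_mat)
  interpret D: ring "ring_mat TYPE(dual_complex) n ()" by (rule ring_mat)
  have c: "std_mat X \<in> carrier_mat n n" "inf_mat X \<in> carrier_mat n n" using assms by auto
  have "X ^\<^sub>m Suc k = X * X ^\<^sub>m k"
    using D.nat_pow_Suc2[of X k] assms
    by (simp only: pow_mat_ring_pow[OF assms, of _ "()"] ring_mat_simps)
  then have "inf_mat (X ^\<^sub>m Suc k) = std_mat X * inf_mat (X ^\<^sub>m k) + inf_mat X * std_mat X ^\<^sub>m k"
    using assms by (simp add: inf_mat_mult[of _ n] pow_carrier_mat std_mat_pow)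
  also have "\<dots> = msum n (\<lambda>i. std_mat X ^\<^sub>m (Suc k - i) * inf_mat X * std_mat X ^\<^sub>m (i - 1)) {1..Suc k}"
    using R.derivation_pow_Suc[of "std_mat X" "inf_mat X" k] c unfolding Suc
    by (simp only: msum_eq_finsum[where b = "()"] pow_mat_ring_pow[OF c(1), of _ "()"] ring_mat_simps)
  finally show ?case .
qed

text \<open>Both regularity equations for \<open>X\<close> are checked part by part: the standard
  parts hold since \<open>D\<close> is the Drazin inverse of \<open>A\<close>, the infinitesimal
  ones are solved for \<open>V\<close> and \<open>W\<close>. Uniqueness then makes the definite
  description behind \<open>X\<^sup>D\<close> denote.\<close>

lemma dual_drazin_inverse_exists:
  assumes "X \<in> DCz n"
  shows "is_drazin_inverse (Ind_s X) X (X\<^sup>D)"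
proof -
  let ?R = "ring_mat TYPE(complex) n ()"
  let ?S = "ring_mat TYPE(dual_complex) n ()"
  interpret R: ring ?R by (rule ring_mat)
  interpret S: ring ?S by (rule ring_mat)
  define A where "A = std_mat X"
  define k where "k = Ind A"
  define D where "D = drazin_inverse A"
  have X: "X \<in> carrier_mat n n"
    and P: "(1\<^sub>m n - A * D) * inf_mat (X ^\<^sub>m k) * (1\<^sub>m n - A * D) = 0\<^sub>m n n"
    using assms by (auto simp: DCz_def Let_def A_def k_def D_def inf_mat_pow)
  have A: "A \<in> carrier_mat n n" using X by (simp add: A_def)
  have d: "R.drazin k A D"
    using drazin_inverse_complex[OF A] by (simp add: is_drazin_inverse_iff[OF A] k_def D_def)
  then have D: "D \<in> carrier_mat n n" by (simp add: R.drazin_def ring_mat_simps)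
  have Xk: "X ^\<^sub>m k \<in> carrier_mat n n" using X by (rule pow_carrier_mat)
  \<comment> \<open>The infinitesimal part of the next power is expanded in two ways, from
    \<open>X^k X\<close> and from \<open>X X^k\<close>, since the right and left equations use
    different ones.\<close>
  define T where "T = inf_mat (X ^\<^sub>m Suc k)"
  have T2: "T = inf_mat (X ^\<^sub>m k) * A + A ^\<^sub>m k * inf_mat X"
  proof -
    have c: "inf_mat (X ^\<^sub>m k) * A \<in> carrier_mat n n" "A ^\<^sub>m k * inf_mat X \<in> carrier_mat n n"
      using X Xk A by (auto simp: pow_carrier_mat)
    show ?thesis
      using inf_mat_mult[OF Xk X] comm_add_mat[OF c] by (simp add: T_def A_def std_mat_pow[OF X])
  qed
  have "X ^\<^sub>m Suc k = X * X ^\<^sub>m k"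
    using S.nat_pow_Suc2[of X k] X
    by (simp only: pow_mat_ring_pow[OF X, of _ "()"] ring_mat_simps)
  then have T1: "T = A * inf_mat (X ^\<^sub>m k) + inf_mat X * A ^\<^sub>m k"
    using X Xk by (simp add: T_def A_def std_mat_pow inf_mat_mult[OF X Xk])
  have minus: "1\<^sub>m n - A * D = \<one>\<^bsub>?R\<^esub> \<ominus>\<^bsub>?R\<^esub> A \<otimes>\<^bsub>?R\<^esub> D"
    using A D by (simp add: ring_mat_minus ring_mat_simps)
  note pow = pow_mat_ring_pow[OF A, of _ "()"]
  have V: "\<exists>V \<in> carrier_mat n n. A ^\<^sub>m Suc k * V + T * D = inf_mat (X ^\<^sub>m k)"
    and W: "\<exists>W \<in> carrier_mat n n. W * A ^\<^sub>m Suc k + D * T = inf_mat (X ^\<^sub>m k)"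
    using R.infinitesimal_pi_regular[of A k D "inf_mat X" "inf_mat (X ^\<^sub>m k)" T] A d X Xk T1 T2 P
    unfolding minus pow ring_mat_simps by simp_all
  have AD: "A ^\<^sub>m Suc k * D = A ^\<^sub>m k" "D * A ^\<^sub>m Suc k = A ^\<^sub>m k"
  proof -
    have Ac: "A \<in> carrier ?R" and Dc: "D \<in> carrier ?R" using A D by (auto simp: ring_mat_simps)
    note E = R.drazin_idem[OF Ac d]
    have "A [^]\<^bsub>?R\<^esub> Suc k \<otimes>\<^bsub>?R\<^esub> D = A [^]\<^bsub>?R\<^esub> k"
      using E(6) Ac Dc by (simp add: R.m_assoc)
    then show "A ^\<^sub>m Suc k * D = A ^\<^sub>m k" unfolding pow ring_mat_simps .
    have "D \<otimes>\<^bsub>?R\<^esub> A [^]\<^bsub>?R\<^esub> Suc k = D \<otimes>\<^bsub>?R\<^esub> A \<otimes>\<^bsub>?R\<^esub> A [^]\<^bsub>?R\<^esub> k"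
      unfolding R.nat_pow_Suc2[OF Ac] using Ac Dc by (simp add: R.m_assoc)
    also have "\<dots> = A [^]\<^bsub>?R\<^esub> k" using E(7) d by (simp add: R.drazin_def)
    finally show "D * A ^\<^sub>m Suc k = A ^\<^sub>m k" unfolding pow ring_mat_simps .
  qed
  obtain V where V: "V \<in> carrier_mat n n" "A ^\<^sub>m Suc k * V + T * D = inf_mat (X ^\<^sub>m k)" using V by blast
  obtain W where W: "W \<in> carrier_mat n n" "W * A ^\<^sub>m Suc k + D * T = inf_mat (X ^\<^sub>m k)" using W by blast
  obtain V' where V': "V' \<in> carrier_mat n n" "std_mat V' = D" "inf_mat V' = V"
    using dual_mat_exists[OF D V(1)] .
  obtain W' where W': "W' \<in> carrier_mat n n" "std_mat W' = D" "inf_mat W' = W"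
    using dual_mat_exists[OF D W(1)] .
  have Xk': "X ^\<^sub>m Suc k \<in> carrier_mat n n" using X by (rule pow_carrier_mat)
  have R: "X ^\<^sub>m k = X ^\<^sub>m Suc k * V'"
  proof (rule dual_mat_eqI)
    show "X ^\<^sub>m Suc k * V' \<in> carrier_mat n n" using Xk' V' by simp
    show "std_mat (X ^\<^sub>m k) = std_mat (X ^\<^sub>m Suc k * V')"
      by (simp only: std_mat_mult[OF Xk' V'(1)] std_mat_pow[OF X] V' A_def[symmetric] AD)
    show "inf_mat (X ^\<^sub>m k) = inf_mat (X ^\<^sub>m Suc k * V')"
      by (simp only: inf_mat_mult[OF Xk' V'(1)] std_mat_pow[OF X] V' A_def[symmetric] V T_def[symmetric])
  qed (rule Xk)
  have L: "X ^\<^sub>m k = W' * X ^\<^sub>m Suc k"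
  proof (rule dual_mat_eqI)
    show "W' * X ^\<^sub>m Suc k \<in> carrier_mat n n" using Xk' W' by simp
    show "std_mat (X ^\<^sub>m k) = std_mat (W' * X ^\<^sub>m Suc k)"
      by (simp only: std_mat_mult[OF W'(1) Xk'] std_mat_pow[OF X] W' A_def[symmetric] AD)
    have c: "D * T \<in> carrier_mat n n" "W * A ^\<^sub>m Suc k \<in> carrier_mat n n"
      using D W(1) A Xk' by (auto simp: T_def pow_carrier_mat simp del: pow_mat.simps)
    show "inf_mat (X ^\<^sub>m k) = inf_mat (W' * X ^\<^sub>m Suc k)"
      by (simp only: inf_mat_mult[OF W'(1) Xk'] std_mat_pow[OF X] W' A_def[symmetric] W(2)
          T_def[symmetric] comm_add_mat[OF c])
  qed (rule Xk)
  have "\<exists>Y. S.drazin k X Y"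
    by (rule S.drazin_exists[of X V' W'])
      (use X V'(1) W'(1) R L in \<open>simp_all only: ring_mat_simps pow_mat_ring_pow[OF X, of _ "()"]\<close>)
  then obtain Y where Y: "is_drazin_inverse (Ind_s X) X Y"
    by (auto simp: is_drazin_inverse_iff[OF X] Ind_s_def k_def A_def)
  show ?thesis
    unfolding dual_drazin_inverse_def
    by (rule theI, rule Y) (rule is_drazin_inverse_unique[OF X _ Y])
qed

section \<open>The block matrix\<close>

lemma minus_four_block_mat:
  assumes "A1 \<in> carrier_mat nr1 nc1" "B1 \<in> carrier_mat nr1 nc2" "C1 \<in> carrier_mat nr2 nc1"
    "D1 \<in> carrier_mat nr2 nc2" "A2 \<in> carrier_mat nr1 nc1" "B2 \<in> carrier_mat nr1 nc2"
    "C2 \<in> carrier_mat nr2 nc1" "D2 \<in> carrier_mat nr2 nc2"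
  shows "four_block_mat A1 B1 C1 D1 - four_block_mat A2 B2 C2 D2
    = four_block_mat (A1 - A2) (B1 - B2) (C1 - C2) (D1 - D2)"
  using assms by (intro eq_matI) auto

text \<open>The block matrix \<open>M\<close> satisfies \<open>M\<^sup>2 = a M + b\<close>, with \<open>a\<close>, \<open>b\<close> acting diagonally and commuting with \<open>M\<close>.\<close>

lemma nilpotent_companion_block:
  fixes a b q :: "'a::comm_ring_1 mat"
  assumes carr: "a \<in> carrier_mat n n" "b \<in> carrier_mat n n" "q \<in> carrier_mat n n"
    and comm: "a * b = b * a" "a * q = q * a" and qq: "q * q = q" and bq: "b * q = b" "q * b = b"
    and nil: "a ^\<^sub>m s = 0\<^sub>m n n" "b ^\<^sub>m t = 0\<^sub>m n n"
  shows "four_block_mat (a * q) b q (0\<^sub>m n n) ^\<^sub>m (2 * (s + t)) = 0\<^sub>m (n + n) (n + n)"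
proof -
  let ?R = "ring_mat TYPE('a) (n + n) ()"
  interpret ring ?R by (rule ring_mat)
  define M where "M = four_block_mat (a * q) b q (0\<^sub>m n n)"
  define Da where "Da = four_block_mat a (0\<^sub>m n n) (0\<^sub>m n n) a"
  define Db where "Db = four_block_mat b (0\<^sub>m n n) (0\<^sub>m n n) b"
  have c: "M \<in> carrier_mat (n + n) (n + n)" "Da \<in> carrier_mat (n + n) (n + n)"
    "Db \<in> carrier_mat (n + n) (n + n)"
    using carr by (auto simp: M_def Da_def Db_def)
  then have cR: "M \<in> carrier ?R" "Da \<in> carrier ?R" "Db \<in> carrier ?R" by (auto simp: ring_mat_simps)
  note assoc = assoc_mult_mat[of _ n n _ n _ n]
  note mult = mult_four_block_mat[of _ n n _ n _ n _ _ n _ n]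
  have aqa: "a * q * a = a * (a * q)" and aqaq: "a * q * (a * q) = a * (a * q)"
    and aqb: "a * q * b = a * b" and qaq: "q * (a * q) = a * q" and baq: "b * (a * q) = a * b"
  proof -
    show "a * q * a = a * (a * q)" by (metis assoc[OF carr(1,3,1)] comm(2))
    show 1: "q * (a * q) = a * q" by (metis assoc[OF carr(3,1,3)] assoc[OF carr(1,3,3)] comm(2) qq)
    have aq: "a * q \<in> carrier_mat n n" using carr by simp
    show "a * q * (a * q) = a * (a * q)" by (simp only: assoc[OF carr(1,3) aq] 1)
    show "a * q * b = a * b" by (simp only: assoc[OF carr(1,3,2)] bq)
    show "b * (a * q) = a * b"
      by (metis assoc[OF carr(2,1,3)] assoc[OF carr(1,2,3)] comm(1) bq(1))
  qed
  have DaM: "Da * M = four_block_mat (a * (a * q)) (a * b) (a * q) (0\<^sub>m n n)"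
    unfolding Da_def M_def by (subst mult) (use carr in auto)
  have MM: "M * M = Da * M + Db"
    unfolding DaM unfolding Db_def M_def
    by (subst mult, use carr in simp_all, subst add_four_block_mat[of _ n n _ n _ n])
      (use carr aqaq aqb qaq bq in auto)
  have MDa: "M * Da = Da * M"
    unfolding DaM unfolding Da_def M_def
    by (subst mult) (use carr aqa comm in auto)
  have MDb: "M * Db = Db * M"
    unfolding Db_def M_def
    by (subst mult, use carr in simp_all, subst mult) (use carr aqb baq comm bq in auto)
  have DD: "Da * Db = Db * Da"
    unfolding Da_def Db_def
    by (subst mult, use carr in simp_all, subst mult) (use carr comm in auto)
  have Da: "Da [^]\<^bsub>?R\<^esub> s = \<zero>\<^bsub>?R\<^esub>" and Db: "Db [^]\<^bsub>?R\<^esub> t = \<zero>\<^bsub>?R\<^esub>"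
    unfolding pow_mat_ring_pow[OF c(2), symmetric] pow_mat_ring_pow[OF c(3), symmetric]
    unfolding Da_def Db_def by (simp_all add: pow_four_block_mat[OF carr(1) carr(1)]
        pow_four_block_mat[OF carr(2) carr(2)] nil ring_mat_simps)
  note R = MM[folded ring_mat_simps(1)[of "TYPE('a)" "n + n" "()"] ring_mat_simps(2)[of "TYPE('a)" "n + n" "()"]]
    MDa[folded ring_mat_simps(1)[of "TYPE('a)" "n + n" "()"]]
    MDb[folded ring_mat_simps(1)[of "TYPE('a)" "n + n" "()"]]
    DD[folded ring_mat_simps(1)[of "TYPE('a)" "n + n" "()"]]
  \<comment> \<open>\<open>Da\<close> commutes with \<open>M\<close>, so \<open>Da M\<close>
    inherits nilpotency from \<open>Da\<close>, and it commutes with \<open>Db\<close>. The square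
    of \<open>M\<close> is thus a sum of commuting nilpotents, and the exponent doubles for
    \<open>M\<close> itself.\<close>
  have 1: "(Da \<otimes>\<^bsub>?R\<^esub> M) [^]\<^bsub>?R\<^esub> s = \<zero>\<^bsub>?R\<^esub>"
    using pow_mult_distrib[OF R(2)[symmetric] cR(2,1), of s] cR by (simp add: Da)
  have 2: "Da \<otimes>\<^bsub>?R\<^esub> M \<otimes>\<^bsub>?R\<^esub> Db = Db \<otimes>\<^bsub>?R\<^esub> (Da \<otimes>\<^bsub>?R\<^esub> M)"
    using cR R(3,4) by (metis m_assoc)
  have "(M \<otimes>\<^bsub>?R\<^esub> M) [^]\<^bsub>?R\<^esub> (s + t) = \<zero>\<^bsub>?R\<^esub>"
    unfolding R(1) by (rule nilpotent_add[OF _ cR(3) 2 1 Db]) (use cR in simp)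
  moreover have "M \<otimes>\<^bsub>?R\<^esub> M = M [^]\<^bsub>?R\<^esub> (2::nat)" using cR by (simp add: numeral_2_eq_2)
  ultimately have "M [^]\<^bsub>?R\<^esub> (2 * (s + t)) = \<zero>\<^bsub>?R\<^esub>" using cR by (simp add: nat_pow_pow)
  then show ?thesis
    unfolding pow_mat_ring_pow[OF c(1), symmetric] by (simp add: M_def ring_mat_simps)
qed

theorem theorem3p1:
  fixes A B N :: "dual_complex mat" and m iA iB :: nat
  assumes "N = four_block_mat A B (1\<^sub>m m) (0\<^sub>m m m)"
    and "N \<in> DCz (m + m)"
    and "A \<in> DCz m" and "B \<in> DCz m"
    and "Ind_s A = iA" and "Ind_s B = iB"
    and "A * A\<^sup>\<pi> * B = B * A * A\<^sup>\<pi>"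
    and "A * A\<^sup>e * B = 0\<^sub>m m m"
  shows "N\<^sup>D = four_block_mat
    (msum m (\<lambda>i. B\<^sup>\<pi> * B ^\<^sub>m i * A ^D (2 * i + 1)) {0..<iB})
    (B\<^sup>e)
    (msum m (\<lambda>i. B\<^sup>\<pi> * B ^\<^sub>m i * A ^D (2 * i + 2)) {0..<iB} + B\<^sup>D * A\<^sup>\<pi>)
    (- (A * A\<^sup>\<pi> * B\<^sup>D))"
proof -
  let ?R = "ring_mat TYPE(dual_complex) m ()"
  let ?T = "ring_mat TYPE(dual_complex) (m + m) ()"
  interpret R: ring ?R by (rule ring_mat)
  interpret T: ring ?T by (rule ring_mat)
  define D where "D = A\<^sup>D"
  define F where "F = B\<^sup>D"
  have A: "A \<in> carrier_mat m m" and B: "B \<in> carrier_mat m m" and N: "N \<in> carrier_mat (m + m) (m + m)"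
    using assms(2-4) by (auto simp: DCz_def)
  have dA: "R.drazin iA A D" and dB: "R.drazin iB B F"
    using dual_drazin_inverse_exists[OF assms(3)] dual_drazin_inverse_exists[OF assms(4)] assms(5,6)
    by (simp_all add: is_drazin_inverse_iff[OF A] is_drazin_inverse_iff[OF B] D_def F_def)
  have D: "D \<in> carrier_mat m m" and F: "F \<in> carrier_mat m m"
    using dA dB by (auto simp: R.drazin_def ring_mat_simps)
  have pi: "\<one>\<^bsub>?R\<^esub> \<ominus>\<^bsub>?R\<^esub> A \<otimes>\<^bsub>?R\<^esub> D = A\<^sup>\<pi>" "\<one>\<^bsub>?R\<^esub> \<ominus>\<^bsub>?R\<^esub> B \<otimes>\<^bsub>?R\<^esub> F = B\<^sup>\<pi>"
    using A B D F by (simp_all add: ring_mat_minus ring_mat_simps dual_pi_def dual_e_def D_def F_def)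
  interpret bd: drazin_block ?R A B D F iA iB
    by unfold_locales
      (use A B dA dB assms(7,8) in \<open>simp_all add: pi\<close>,
        simp_all add: ring_mat_simps dual_e_def D_def F_def)
  define p where "p = bd.p"
  define q where "q = bd.q"
  define a where "a = bd.a"
  define U where "U = bd.U"
  define w where "w = bd.w"
  note f = p_def[symmetric] q_def[symmetric] a_def[symmetric] U_def[symmetric] w_def[symmetric]
  have c: "p \<in> carrier_mat m m" "q \<in> carrier_mat m m" "a \<in> carrier_mat m m"
      "U \<in> carrier_mat m m" "w \<in> carrier_mat m m"
    using bd.closed bd.w_closed by (simp_all add: p_def q_def a_def U_def w_def ring_mat_simps)
  have pq: "A\<^sup>\<pi> = p" "B\<^sup>\<pi> = q"
    by (simp_all add: p_def q_def bd.p_def bd.q_def pi)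
  have a_eq: "A * p = a" by (simp add: p_def a_def bd.a_def ring_mat_simps)
  have U_eq: "msum m (\<lambda>i. q * B ^\<^sub>m i * D ^\<^sub>m (2 * i + 1)) {0..<iB} = U"
    by (simp only: U_def q_def bd.U_def bd.psum_def msum_eq_finsum[where b = "()"] ring_mat_simps
        pow_mat_ring_pow[OF B, of _ "()"] pow_mat_ring_pow[OF D, of _ "()"])
  have UD_eq: "msum m (\<lambda>i. q * B ^\<^sub>m i * D ^\<^sub>m (2 * i + 2)) {0..<iB} = U * D"
    using bd.U_shift
    by (simp only: U_def q_def msum_eq_finsum[where b = "()"] ring_mat_simps
        pow_mat_ring_pow[OF B, of _ "()"] pow_mat_ring_pow[OF D, of _ "()"])
  note carr = A B D F c
  \<comment> \<open>Ring negation and subtraction become matrix operations on these carriers, which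
    turns the abstract block identities into literal matrix equations.\<close>
  have pm: "\<ominus>\<^bsub>?R\<^esub> (a * F) = - (a * F)" "\<ominus>\<^bsub>?R\<^esub> U = - U"
    "a * q \<ominus>\<^bsub>?R\<^esub> B * U = a * q - B * U" "1\<^sub>m m \<ominus>\<^bsub>?R\<^esub> w = 1\<^sub>m m - w" "q \<ominus>\<^bsub>?R\<^esub> U * A = q - U * A"
    using carr by (simp_all add: ring_mat_minus ring_mat_uminus)
  note block = bd.block11 bd.block12 bd.block21 bd.block22
  note block = block[unfolded f ring_mat_simps, unfolded pm]
  note idem = bd.idem11 bd.idem21 bd.idem22
  note idem = idem[unfolded f ring_mat_simps, unfolded pm]
  note compl = bd.compl11 bd.compl21 bd.U_null
  note compl = compl[unfolded f ring_mat_simps, unfolded pm]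
  \<comment> \<open>\<open>X\<close> is the right-hand side of the claim with its sums written as
    \<open>U\<close> and \<open>U D\<close>; \<open>E\<close> is the common value of
    \<open>N X\<close> and \<open>X N\<close>.\<close>
  define X where "X = four_block_mat U (B * F) (U * D + F * p) (- (a * F))"
  define E where "E = four_block_mat w (0\<^sub>m m m) U (B * F)"
  have X: "X \<in> carrier_mat (m + m) (m + m)" and E: "E \<in> carrier_mat (m + m) (m + m)"
    using carr by (auto simp: X_def E_def)
  note mult = mult_four_block_mat[of _ m m _ m _ m _ _ m _ m]
  have neg_zero: "- (0\<^sub>m m m :: dual_complex mat) = 0\<^sub>m m m" by (intro eq_matI) auto
  have NX: "N * X = E"
    unfolding assms(1) X_def E_def by (subst mult) (use carr block in \<open>simp_all add: neg_zero\<close>)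
  have XN: "X * N = E"
    unfolding assms(1) X_def E_def by (subst mult) 
      (use carr block bd.UB bd.w_def in \<open>simp_all add: f ring_mat_simps neg_zero\<close>)
  have XE: "X * E = X"
    unfolding E_def X_def by (subst mult) (use carr idem in \<open>simp_all add: neg_zero\<close>)
  have q_eq: "1\<^sub>m m - B * F = q" using B F pi(2) pq by (simp add: ring_mat_minus ring_mat_simps)
  have minus_carr: "q - U * A \<in> carrier_mat m m" "a * q - B * U \<in> carrier_mat m m"
    using carr by (auto intro!: minus_carrier_mat)
  \<comment> \<open>\<open>K\<close> is \<open>N (I - N X)\<close>. The terms containing
    \<open>U\<close> are collected in \<open>M2\<close>, which leaves in \<open>M1\<close> a block
    matrix of the shape handled by \<open>nilpotent_companion_block\<close>.\<close>
  define M1 where "M1 = four_block_mat (a * q) (B * q) q (0\<^sub>m m m)"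
  define M2 where "M2 = four_block_mat (- (B * U)) (0\<^sub>m m m) (- (U * A)) (0\<^sub>m m m)"
  define K where "K = four_block_mat (a * q - B * U) (B * q) (q - U * A) (0\<^sub>m m m)"
  have cM: "M1 \<in> carrier_mat (m + m) (m + m)" "M2 \<in> carrier_mat (m + m) (m + m)"
    "K \<in> carrier_mat (m + m) (m + m)"
    using carr by (auto simp: M1_def M2_def K_def)
  have "1\<^sub>m (m + m) - E = four_block_mat (1\<^sub>m m - w) (0\<^sub>m m m) (- U) q"
    unfolding E_def four_block_one_mat[symmetric]
    by (subst minus_four_block_mat[of _ m m _ m _ m]) (use carr q_eq in auto)
  then have NE: "N * (1\<^sub>m (m + m) - E) = K"
    unfolding assms(1) K_def
    by (simp, subst mult)
      (use carr minus_carr compl in \<open>simp_all add: neg_zero\<close>)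
  have K_eq: "K = M1 + M2"
    unfolding K_def M1_def M2_def
    by (subst add_four_block_mat[of _ m m _ m _ m]) (use carr in \<open>auto simp: add_uminus_minus_mat\<close>)
  have M2K: "M2 * K = 0\<^sub>m (m + m) (m + m)"
    unfolding M2_def K_def
    by (subst mult) (use carr minus_carr compl in \<open>simp_all add: neg_zero assoc_mult_mat[of _ m m _ m _ m]\<close>)
  have "M1 ^\<^sub>m (2 * (Suc iA + Suc iB)) = 0\<^sub>m (m + m) (m + m)"
    unfolding M1_def
  proof (rule nilpotent_companion_block)
    show "a ^\<^sub>m Suc iA = 0\<^sub>m m m" "(B * q) ^\<^sub>m Suc iB = 0\<^sub>m m m"
      using bd.a_nilpotent bd.Bq_nilpotent carr
      by (simp_all only: pow_mat_ring_pow[of _ m _ "()"] mult_carrier_mat f ring_mat_simps)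
    show "a * (B * q) = B * q * a" using bd.a_Bq by (simp add: f ring_mat_simps)
    show "a * q = q * a" using bd.aq by (simp add: f ring_mat_simps)
    show "q * q = q" using bd.qq by (simp add: f ring_mat_simps)
    show "B * q * q = B * q" "q * (B * q) = B * q" using bd.q_Bq by (simp_all add: f ring_mat_simps)
  qed (use carr in auto)
  then have M1_nil: "M1 [^]\<^bsub>?T\<^esub> (2 * (Suc iA + Suc iB)) = \<zero>\<^bsub>?T\<^esub>"
    by (simp only: pow_mat_ring_pow[OF cM(1), of _ "()"] ring_mat_simps)
  have cT: "M1 \<in> carrier ?T" "M2 \<in> carrier ?T" "K \<in> carrier ?T" "N \<in> carrier ?T" "X \<in> carrier ?T"
    using cM N X by (auto simp: ring_mat_simps)
  have KK: "K \<otimes>\<^bsub>?T\<^esub> K = M1 \<otimes>\<^bsub>?T\<^esub> K"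
  proof -
    have "K * K = M1 * K + M2 * K"
      using add_mult_distrib_mat[OF cM(1,2,3)] K_eq by simp
    then show ?thesis using cM M2K by (simp add: ring_mat_simps)
  qed
  \<comment> \<open>Repeated use of \<open>K K = M1 K\<close> turns all but the last factor into
    \<open>M1\<close>, so one exponent beyond the nilpotency exponent of \<open>M1\<close>
    suffices.\<close>
  have K_pow: "K [^]\<^bsub>?T\<^esub> Suc j = M1 [^]\<^bsub>?T\<^esub> j \<otimes>\<^bsub>?T\<^esub> K" for j :: nat
  proof (induction j)
    case (Suc j)
    have "K [^]\<^bsub>?T\<^esub> Suc (Suc j) = M1 [^]\<^bsub>?T\<^esub> j \<otimes>\<^bsub>?T\<^esub> (K \<otimes>\<^bsub>?T\<^esub> K)"
      unfolding T.nat_pow_Suc[of _ "Suc j"] Suc using cT by (simp add: T.m_assoc)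
    then show ?case unfolding KK using cT by (simp add: T.m_assoc)
  qed (use cT in simp)
  have "N \<otimes>\<^bsub>?T\<^esub> (\<one>\<^bsub>?T\<^esub> \<ominus>\<^bsub>?T\<^esub> N \<otimes>\<^bsub>?T\<^esub> X) = K"
    using NE NX E by (simp add: ring_mat_minus ring_mat_simps)
  moreover have "K [^]\<^bsub>?T\<^esub> Suc (2 * (Suc iA + Suc iB)) = \<zero>\<^bsub>?T\<^esub>"
    unfolding K_pow M1_nil using cT by simp
  ultimately have "T.drazin (Suc (2 * (Suc iA + Suc iB))) N X"
    using cT NX XN XE by (intro T.drazin_if_nilpotent) (simp_all only: ring_mat_simps)
  then have "is_drazin_inverse (Suc (2 * (Suc iA + Suc iB))) N X"
    by (simp only: is_drazin_inverse_iff[OF N])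
  \<comment> \<open>The exponent obtained for \<open>X\<close> need not be \<open>Ind_s N\<close>.
    Membership of \<open>N\<close> in \<open>DCz\<close> supplies an inverse of that index, and
    uniqueness across indices identifies the two.\<close>
  then have "N\<^sup>D = X"
    using is_drazin_inverse_unique[OF N dual_drazin_inverse_exists[OF assms(2)]] by blast
  then show ?thesis
    by (simp only: X_def pq a_eq dual_e_def D_def[symmetric] F_def[symmetric] U_eq UD_eq)
qed

end
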